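(* Let $p=2n+1$ be an odd prime and let $K(r)$, $0<r<1$, be a $2$-bridge knot with $\Delta_{K(r)}(-1)\equiv 0 \pmod p$. Then there is an integer polynomial $f(t)$ such that (1) $D_{\tau,K(r)}(t)\equiv f(t)f(-t)\pmod p$, and (2) $f(t)\equiv\left\{\dfrac{\Delta_{K(r)}(t)}{1+t}\right\}^n \pmod p$. If moreover $K(r)$ belongs to $H(p)$, then $f(t)$ can be taken so that the equality $D_{\tau,K(r)}(t)=f(t)f(-t)$ holds over $\mathbb{Z}$. (All equalities and congruences are up to multiplication by units $\pm t^k$, $k\in\mathbb{Z}$.)
   Context: Notation. $D_p=\langle x,y\mid x^2=y^2=(xy)^p=1\rangle$ is the dihedral group of order $2p$. For coprime integers $0<\beta<\alpha$ with $\alpha$ odd and $r=\beta/\alpha$, $K(r)$ is the corresponding $2$-bridge knot in $S^3$. Its group has the standard Wirtinger presentation $G(K(r))=\langle x,y\mid R\rangle$ with $R=WxW^{-1}y^{-1}$, $W=x^{\epsilon_1}y^{\epsilon_2}\cdots x^{\epsilon_{\alpha-2}}y^{\epsilon_{\alpha-1}}$, $\epsilon_j=\pm1$ (explicitly $\epsilon_j=(-1)^{\lfloor j\beta/\alpha\rfloor}$ if $\beta$ is odd and $\epsilon_j=(-1)^{\lfloor j\beta/\alpha\rfloor+j}$ if $\beta$ is even). $\Delta_{K(r)}(t)$ is the Alexander polynomial. The condition $\Delta_{K(r)}(-1)\equiv0\pmod p$ is equivalent to $p\mid\alpha$; in that case $x\mapsto x$, $y\mapsto y$ defines an epimorphism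 $\rho:G(K(r))\to D_p$, and $\Delta_{K(r)}(t)$ is divisible by $1+t$ in $(\mathbb{Z}/p)[t^{\pm1}]$. $H(p)$ is the set of $2$-bridge knots $K(r)$, $0<r<1$, whose group $G(K(r))$ maps onto the free product $\mathbb{Z}/2*\mathbb{Z}/p$ (such knots satisfy $\Delta_{K(r)}(-1)\equiv 0\pmod p$). Let $\theta_n(z)=\sum_{k=0}^n\frac{2n+1}{2k+1}\binom{n+k}{n-k}z^k$, which is irreducible over $\mathbb{Q}$, with roots $\omega_1,\dots,\omega_n$. For a root $\omega$ of $\theta_n$, the assignment $\xi(x)=\begin{bmatrix}-1&1\\0&1\end{bmatrix}$, $\xi(y)=\begin{bmatrix}-1&0\\\omega&1\end{bmatrix}$ defines a representation $\xi:D_p\to GL(2,\mathbb{C})$; let $\tau:G(K(r))\to GL(2,\mathbb{C})$ be $\rho$ followed by $\xi$. Twisted Alexander polynomial (Wada): for a representation $\sigma:G(K(r))\to GL(m,A)$, $\widetilde\Delta_{\sigma,K(r)}(t)=\det\Phi(\partial R/\partial x)/\det\Phi(y-1)$, where $\partial/\partial x$ is the Fox free derivative and $\Phi$ is the ring homomorphism from $\mathbb{Z}[F(x,y)]$ ($F(x,y)$ the free group) to $m\times m$ matrices over $A[t^{\pm1}]$ with $\Phi(x)=\sigma(x)t$, $\Phi(y)=\sigma(y)t$. Write $\widetilde\Delta_{\tau,K(r)}(t|\omega)$ for the polynomial of $\tau$ with parameter $\omega$. The total twisted Alexander polynomial is $D_{\tau,K(r)}(t)=\prod_{j=1}^n\widetilde\Delta_{\tau,K(r)}(t|\omega_j)$.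 All Alexander and twisted Alexander polynomials are considered up to units $\pm t^k$. *)

theory Defs
  imports
    "HOL-Analysis.Determinants"
    "HOL-Algebra.Elementary_Groups"
    "HOL-Number_Theory.Cong"
    "HOL-Computational_Algebra.Computational_Algebra"
begin

section \<open>Group presentations and free products\<close>

text \<open>The letter \<open>(g, True)\<close> stands for the generator \<open>g\<close>, and \<open>(g, False)\<close> for its inverse.\<close>

type_synonym 'g word = "('g \<times> bool) list"

definition inv_word :: "'g word \<Rightarrow> 'g word" where
  "inv_word w = rev (map (\<lambda>(g, b). (g, \<not> b)) w)"

text \<open>Words over the generators in \<open>S\<close>, modulo the congruence generated by free cancellation
  and by the relators in \<open>Rs\<close>.\<close>

inductive word_equiv :: "'g set \<Rightarrow> 'g word set \<Rightarrow> 'g word \<Rightarrow> 'g word \<Rightarrow> bool" for S Rs where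
  refl: "word_equiv S Rs w w"
| sym: "word_equiv S Rs u v \<Longrightarrow> word_equiv S Rs v u"
| trans: "word_equiv S Rs u v \<Longrightarrow> word_equiv S Rs v w \<Longrightarrow> word_equiv S Rs u w"
| cancel: "g \<in> S \<Longrightarrow> word_equiv S Rs (u @ [(g, b), (g, \<not> b)] @ v) (u @ v)"
| relator: "r \<in> Rs \<Longrightarrow> word_equiv S Rs (u @ r @ v) (u @ v)"

definition words :: "'g set \<Rightarrow> 'g word set" where
  "words S = lists (S \<times> UNIV)"

definition word_rel :: "'g set \<Rightarrow> 'g word set \<Rightarrow> ('g word \<times> 'g word) set" where
  "word_rel S Rs = {(u, v). u \<in> words S \<and> v \<in> words S \<and> word_equiv S Rs u v}"

definition presented_group :: "'g set \<Rightarrow> 'g word set \<Rightarrow> 'g word set monoid" where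
  "presented_group S Rs =
     \<lparr>carrier = words S // word_rel S Rs,
      monoid.mult = (\<lambda>A B. \<Union>a\<in>A. \<Union>b\<in>B. word_rel S Rs `` {a @ b}),
      one = word_rel S Rs `` {[]}\<rparr>"

lemma equiv_word_rel: "equiv (words S) (word_rel S Rs)"
proof (rule equivI)
  show "refl_on (words S) (word_rel S Rs)"
    by (auto simp: refl_on_def word_rel_def word_equiv.refl)
  show "sym (word_rel S Rs)"
    by (auto simp: sym_def word_rel_def word_equiv.sym)
  show "trans (word_rel S Rs)"
    unfolding trans_def word_rel_def using word_equiv.trans[of S Rs] by blast
qed (auto simp: word_rel_def)

lemma word_equiv_context:
  "word_equiv S Rs u v \<Longrightarrow> word_equiv S Rs (a @ u @ b) (a @ v @ b)"
proof (induction rule: word_equiv.induct)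
  case (refl w)
  show ?case by (rule word_equiv.refl)
next
  case (sym u v)
  show ?case by (rule word_equiv.sym[OF sym.IH])
next
  case (trans u v w)
  show ?case by (rule word_equiv.trans[OF trans.IH])
next
  case (cancel g u b' v)
  then show ?case
    using word_equiv.cancel[of g S Rs "a @ u" b' "v @ b"] by simp
next
  case (relator r u v)
  then show ?case
    using word_equiv.relator[of r Rs S "a @ u" "v @ b"] by simp
qed

lemma word_equiv_append:
  assumes "word_equiv S Rs u u'" "word_equiv S Rs v v'"
  shows "word_equiv S Rs (u @ v) (u' @ v')"
proof -
  have "word_equiv S Rs (u @ v) (u' @ v)"
    using word_equiv_context[OF assms(1), of "[]" v] by simp
  moreover have "word_equiv S Rs (u' @ v) (u' @ v')"
    using word_equiv_context[OF assms(2), of u' "[]"] by simp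
  ultimately show ?thesis
    by (rule word_equiv.trans)
qed

lemma words_append [simp]: "u @ v \<in> words S \<longleftrightarrow> u \<in> words S \<and> v \<in> words S"
  by (auto simp: words_def)

lemma words_Nil [simp]: "[] \<in> words S"
  by (simp add: words_def)

lemma inv_word_words: "w \<in> words S \<Longrightarrow> inv_word w \<in> words S"
  by (auto simp: words_def inv_word_def in_lists_conv_set)

lemma word_equiv_inv_left: "w \<in> words S \<Longrightarrow> word_equiv S Rs (inv_word w @ w) []"
proof (induction w)
  case Nil
  then show ?case by (simp add: inv_word_def word_equiv.refl)
next
  case (Cons l w)
  obtain g b where l: "l = (g, b)" by fastforce
  have g: "g \<in> S" and w: "w \<in> words S"
    using Cons.prems by (auto simp: words_def l)
  have "word_equiv S Rs (inv_word (l # w) @ l # w) (inv_word w @ w)"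
    using word_equiv.cancel[OF g, of Rs "inv_word w" "\<not> b" w] by (simp add: l inv_word_def)
  then show ?case
    using Cons.IH[OF w] word_equiv.trans by blast
qed

lemma presented_group_mult:
  assumes "u \<in> words S" "v \<in> words S"
  shows "word_rel S Rs `` {u} \<otimes>\<^bsub>presented_group S Rs\<^esub> word_rel S Rs `` {v} =
         word_rel S Rs `` {u @ v}"
proof -
  let ?A = "word_rel S Rs `` {u}" and ?B = "word_rel S Rs `` {v}"
  let ?F = "\<lambda>a b. word_rel S Rs `` {a @ b}"
  have eq: "?F a b = ?F u v" if "a \<in> ?A" "b \<in> ?B" for a b
  proof -
    have "(u @ v, a @ b) \<in> word_rel S Rs"
      using that by (auto simp: word_rel_def intro: word_equiv_append)
    from equiv_class_eq[OF equiv_word_rel this] show ?thesis ..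
  qed
  have u: "u \<in> ?A" and v: "v \<in> ?B"
    using assms by (auto simp: word_rel_def word_equiv.refl)
  have "(\<Union>a\<in>?A. \<Union>b\<in>?B. ?F a b) = ?F u v"
  proof
    show "(\<Union>a\<in>?A. \<Union>b\<in>?B. ?F a b) \<subseteq> ?F u v"
    proof (intro UN_least)
      fix a b assume "a \<in> ?A" "b \<in> ?B"
      from eq[OF this] show "?F a b \<subseteq> ?F u v" by (rule equalityD1)
    qed
    show "?F u v \<subseteq> (\<Union>a\<in>?A. \<Union>b\<in>?B. ?F a b)"
      using u v by blast
  qed
  then show ?thesis
    unfolding presented_group_def monoid.simps .
qed

lemma group_presented_group: "group (presented_group S Rs)"
proof (rule groupI)
  let ?G = "presented_group S Rs"
  have carr: "A \<in> carrier ?G \<longleftrightarrow> (\<exists>u\<in>words S. A = word_rel S Rs `` {u})" for A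
    by (auto simp: presented_group_def quotient_def)
  have one: "\<one>\<^bsub>?G\<^esub> = word_rel S Rs `` {[]}"
    by (simp add: presented_group_def)
  show "\<one>\<^bsub>?G\<^esub> \<in> carrier ?G"
    unfolding carr one by auto
  show "A \<otimes>\<^bsub>?G\<^esub> B \<in> carrier ?G" if "A \<in> carrier ?G" "B \<in> carrier ?G" for A B
    using that unfolding carr by (metis presented_group_mult words_append)
  show "A \<otimes>\<^bsub>?G\<^esub> B \<otimes>\<^bsub>?G\<^esub> C = A \<otimes>\<^bsub>?G\<^esub> (B \<otimes>\<^bsub>?G\<^esub> C)"
    if "A \<in> carrier ?G" "B \<in> carrier ?G" "C \<in> carrier ?G" for A B C
    using that unfolding carr by (auto simp: presented_group_mult)
  show "\<one>\<^bsub>?G\<^esub> \<otimes>\<^bsub>?G\<^esub> A = A" if "A \<in> carrier ?G" for A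
    using that unfolding carr one by (auto simp: presented_group_mult)
  show "\<exists>B\<in>carrier ?G. B \<otimes>\<^bsub>?G\<^esub> A = \<one>\<^bsub>?G\<^esub>" if A: "A \<in> carrier ?G" for A
  proof -
    obtain u where u: "u \<in> words S" "A = word_rel S Rs `` {u}"
      using A unfolding carr by blast
    have "(inv_word u @ u, []) \<in> word_rel S Rs"
      using u word_equiv_inv_left inv_word_words by (auto simp: word_rel_def)
    then have "word_rel S Rs `` {inv_word u @ u} = \<one>\<^bsub>?G\<^esub>"
      unfolding one by (rule equiv_class_eq[OF equiv_word_rel])
    then show ?thesis
      using u inv_word_words by (intro bexI[of _ "word_rel S Rs `` {inv_word u}"])
        (auto simp: presented_group_mult carr)
  qed
qed

text \<open>The free product \<open>G * H\<close>: generated by the disjoint union of \<open>G\<close> and \<open>H\<close>,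
  subject to the multiplication tables of both factors.\<close>

definition mult_table :: "('a \<Rightarrow> 'g) \<Rightarrow> ('a, 'm) monoid_scheme \<Rightarrow> 'g word set" where
  "mult_table i G =
     {[(i a, True), (i b, True), (i (a \<otimes>\<^bsub>G\<^esub> b), False)] | a b. a \<in> carrier G \<and> b \<in> carrier G}"

definition free_product ::
  "('a, 'm) monoid_scheme \<Rightarrow> ('b, 'n) monoid_scheme \<Rightarrow> ('a + 'b) word set monoid" where
  "free_product G H =
     presented_group (carrier G <+> carrier H) (mult_table Inl G \<union> mult_table Inr H)"

section \<open>Two-bridge knots\<close>

text \<open>The two-bridge knot \<open>K(r)\<close>, \<open>r = \<beta>/\<alpha>\<close>, is represented by the pair \<open>(\<alpha>, \<beta>)\<close>, and
  enters only through its standard Wirtinger presentation.\<close>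

definition two_bridge :: "nat \<Rightarrow> nat \<Rightarrow> bool" where
  "two_bridge \<alpha> \<beta> \<longleftrightarrow> 0 < \<beta> \<and> \<beta> < \<alpha> \<and> coprime \<alpha> \<beta> \<and> odd \<alpha>"

datatype gen = X | Y

definition eps :: "nat \<Rightarrow> nat \<Rightarrow> nat \<Rightarrow> int" where
  "eps \<alpha> \<beta> j = (if odd \<beta> then (-1) ^ (j * \<beta> div \<alpha>) else (-1) ^ (j * \<beta> div \<alpha> + j))"

definition knot_W :: "nat \<Rightarrow> nat \<Rightarrow> gen word" where
  "knot_W \<alpha> \<beta> = map (\<lambda>j. (if odd j then X else Y, eps \<alpha> \<beta> j = 1)) [1..<\<alpha>]"

definition knot_R :: "nat \<Rightarrow> nat \<Rightarrow> gen word" where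
  "knot_R \<alpha> \<beta> = knot_W \<alpha> \<beta> @ [(X, True)] @ inv_word (knot_W \<alpha> \<beta>) @ [(Y, False)]"

definition knot_group :: "nat \<Rightarrow> nat \<Rightarrow> gen word set monoid" where
  "knot_group \<alpha> \<beta> = presented_group UNIV {knot_R \<alpha> \<beta>}"

definition H_knots :: "nat \<Rightarrow> (nat \<times> nat) set" where
  "H_knots p = {(\<alpha>, \<beta>). two_bridge \<alpha> \<beta> \<and>
     epi (knot_group \<alpha> \<beta>) (free_product (integer_mod_group 2) (integer_mod_group p)) \<noteq> {}}"

section \<open>Fox calculus\<close>

text \<open>\<open>fox g w\<close> is the Fox derivative of \<open>w\<close> with respect to \<open>g\<close>. An element
  \<open>\<Sum>\<^sub>i c\<^sub>i u\<^sub>i\<close> of the integral group ring of the free group is written as the list of the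
  pairs \<open>(c\<^sub>i, u\<^sub>i)\<close>. The recursion is the rule \<open>\<partial>(h w) = \<partial>h + h \<partial>w\<close>, with
  \<open>\<partial>g = 1\<close> and \<open>\<partial>(g\<^sup>-\<^sup>1) = - g\<^sup>-\<^sup>1\<close>.\<close>

fun fox :: "'g \<Rightarrow> 'g word \<Rightarrow> (int \<times> 'g word) list" where
  "fox g [] = []"
| "fox g ((h, b) # w) =
     (if h = g then [if b then (1, []) else (-1, [(h, False)])] else [])
     @ map (\<lambda>(c, u). (c, (h, b) # u)) (fox g w)"

text \<open>Laurent polynomials over \<open>'a\<close> are taken inside the field of fractions of \<open>'a[t]\<close>.\<close>

definition tvar :: "'a::idom poly fract" where
  "tvar = to_fract [:0, 1:]"

definition laurent_polys :: "'a::idom poly fract set" where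
  "laurent_polys = {to_fract f * tvar powi k | f k. True}"

subsection \<open>The Alexander polynomial\<close>

definition exp_sum :: "'g word \<Rightarrow> int" where
  "exp_sum w = (\<Sum>(g, b)\<leftarrow>w. if b then 1 else -1)"

text \<open>Entries of the Alexander matrix: images of the Fox derivatives of \<open>R\<close> under
  abelianization \<open>x, y \<mapsto> t\<close>.\<close>

definition alexander_entry :: "nat \<Rightarrow> nat \<Rightarrow> gen \<Rightarrow> int poly fract" where
  "alexander_entry \<alpha> \<beta> g = (\<Sum>(c, u)\<leftarrow>fox g (knot_R \<alpha> \<beta>). of_int c * tvar powi exp_sum u)"

text \<open>\<open>\<Delta>\<close> is an Alexander polynomial of \<open>K(\<beta>/\<alpha>)\<close> if it generates the first elementary
  ideal in \<open>\<int>[t, t\<^sup>-\<^sup>1]\<close>; this determines \<open>\<Delta>\<close> up to units.\<close>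

definition alexander_polynomial :: "nat \<Rightarrow> nat \<Rightarrow> int poly \<Rightarrow> bool" where
  "alexander_polynomial \<alpha> \<beta> \<Delta> \<longleftrightarrow>
     {a * alexander_entry \<alpha> \<beta> X + b * alexander_entry \<alpha> \<beta> Y | a b.
        a \<in> laurent_polys \<and> b \<in> laurent_polys} =
     {c * to_fract \<Delta> | c. c \<in> laurent_polys}"

subsection \<open>Twisted Alexander polynomials\<close>

text \<open>A representation is given by its values \<open>\<sigma>\<close> on the generators; \<open>\<Phi>(g) = \<sigma>(g) t\<close>.\<close>

definition Phi_gen :: "(gen \<Rightarrow> 'a::idom^'m^'m) \<Rightarrow> gen \<Rightarrow> 'a poly fract^'m^'m" where
  "Phi_gen \<sigma> g = (\<chi> i j. to_fract [:\<sigma> g $ i $ j:] * tvar)"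

fun Phi_word :: "(gen \<Rightarrow> 'a::idom^'m^'m) \<Rightarrow> gen word \<Rightarrow> 'a poly fract^'m^'m" where
  "Phi_word \<sigma> [] = mat 1"
| "Phi_word \<sigma> ((g, b) # w) =
     (if b then Phi_gen \<sigma> g else matrix_inv (Phi_gen \<sigma> g)) ** Phi_word \<sigma> w"

definition Phi :: "(gen \<Rightarrow> 'a::idom^'m^'m) \<Rightarrow> (int \<times> gen word) list \<Rightarrow> 'a poly fract^'m^'m" where
  "Phi \<sigma> s = (\<Sum>(c, u)\<leftarrow>s. mat (of_int c) ** Phi_word \<sigma> u)"

definition twisted_alexander ::
  "nat \<Rightarrow> nat \<Rightarrow> (gen \<Rightarrow> 'a::idom^'m^'m) \<Rightarrow> 'a poly fract" where
  "twisted_alexander \<alpha> \<beta> \<sigma> =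
     det (Phi \<sigma> (fox X (knot_R \<alpha> \<beta>))) / det (Phi \<sigma> [(1, [(Y, True)]), (-1, [])])"

definition theta :: "nat \<Rightarrow> complex poly" where
  "theta n = (\<Sum>k\<le>n. Polynomial.monom
     (of_nat (2 * n + 1) / of_nat (2 * k + 1) * of_nat ((n + k) choose (n - k))) k)"

text \<open>The values on \<open>x\<close>, \<open>y\<close> of the representation \<open>\<xi>\<close> of the dihedral group. The epimorphism
  \<open>\<rho>\<close> sends \<open>x\<close> to \<open>x\<close> and \<open>y\<close> to \<open>y\<close>, so these are also the values of \<open>\<tau> = \<xi> \<circ> \<rho>\<close>.\<close>

fun tau :: "complex \<Rightarrow> gen \<Rightarrow> complex^2^2" where
  "tau \<omega> X = vector [vector [-1, 1], vector [0, 1]]"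
| "tau \<omega> Y = vector [vector [-1, 0], vector [\<omega>, 1]]"

definition total_twisted_alexander :: "nat \<Rightarrow> nat \<Rightarrow> nat \<Rightarrow> complex poly fract" where
  "total_twisted_alexander n \<alpha> \<beta> =
     (\<Prod>\<omega>\<in>#proots (theta n). twisted_alexander \<alpha> \<beta> (tau \<omega>))"

section \<open>Equality and congruence up to units\<close>

definition represents :: "int poly \<Rightarrow> complex poly fract \<Rightarrow> bool" where
  "represents D q \<longleftrightarrow> (\<exists>s\<in>{1, -1}. \<exists>k::int. q = s * tvar powi k * to_fract (map_poly of_int D))"

text \<open>Multiplying by powers of \<open>t\<close> on both sides covers units \<open>t\<^sup>k\<close> with negative \<open>k\<close>.\<close>

definition eq_units :: "int poly \<Rightarrow> int poly \<Rightarrow> bool" where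
  "eq_units f g \<longleftrightarrow> (\<exists>s\<in>{1, -1}. \<exists>k l. [:0, 1:] ^ k * f = s * [:0, 1:] ^ l * g)"

definition cong_units :: "nat \<Rightarrow> int poly \<Rightarrow> int poly \<Rightarrow> bool" where
  "cong_units p f g \<longleftrightarrow>
     (\<exists>s\<in>{1, -1}. \<exists>k l. [:int p:] dvd [:0, 1:] ^ k * f - s * [:0, 1:] ^ l * g)"

text \<open>\<open>f \<equiv> {\<Delta> / (1 + t)}\<^sup>n\<close> mod \<open>p\<close>: the quotient \<open>q\<close> is taken in the Laurent polynomial ring
  over the field with \<open>p\<close> elements, where it is unique up to units.\<close>

definition cong_quotient_power :: "nat \<Rightarrow> nat \<Rightarrow> int poly \<Rightarrow> int poly \<Rightarrow> bool" where
  "cong_quotient_power p n f \<Delta> \<longleftrightarrow>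
     (\<exists>q. cong_units p \<Delta> ([:1, 1:] * q) \<and> cong_units p f (q ^ n))"

end

theory Submission
  imports "Jordan_Normal_Form.Determinant" Defs
begin

text \<open>Write the relator \<open>R\<close> as a word of length \<open>2\<alpha>\<close> whose letters alternate between \<open>x\<^sup>\<plusminus>\<^sup>1\<close> and
\<open>y\<^sup>\<plusminus>\<^sup>1\<close>, and let \<open>e\<^sub>j\<close> be the exponent sum of its first \<open>j\<close> letters. The generators map to
reflections, so the image of this prefix in the dihedral group depends on \<open>j\<close> alone: with a rotation
\<open>b\<close> of order \<open>p\<close> and a reflection \<open>h\<close> such that \<open>\<xi>(x) = b h\<close> and \<open>\<xi>(y) = h b\<close>, it is \<open>b\<^sup>j h\<^sup>j\<close>. By the
product rule, \<open>\<Phi>(\<partial>R/\<partial>x) (\<Phi>(x) - 1)\<close> is the sum, over the letters \<open>x\<^sup>\<plusminus>\<^sup>1\<close> of \<open>R\<close>, of the prefix after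
the letter minus the prefix before it, which is the alternating sum
\<open>- \<Sum>\<^sub>j (-1)\<^sup>j b\<^sup>j h\<^sup>j t^e\<^sub>j\<close> over \<open>0 \<le> j < 2\<alpha>\<close>
(\<open>Phi_fox_alternating\<close>, in an eigenbasis of \<open>b\<close>).

The \<open>j\<close>-th letter is positive when \<open>j \<beta>'\<close> lies in the first half of \<open>\<int>/2\<alpha>\<close>, where \<open>\<beta>'\<close> is the odd one
of \<open>\<beta>\<close> and \<open>\<alpha> + \<beta>\<close>. Hence \<open>e\<close> has period \<open>2\<alpha>\<close>, and it is symmetric about the index \<open>m\<close> with
\<open>(2m + 1) \<beta>' \<equiv> 1\<close> modulo \<open>2\<alpha>\<close>; this is the symmetry of the knot that exchanges \<open>x\<close> and \<open>y\<close>. Recentred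
at \<open>m\<close>, the matrix above commutes with \<open>h\<close>, and on the two eigenlines of \<open>h\<close> it acts by
\<open>S(t)\<close> and \<open>S(-t)\<close>, up to units, where \<open>S(t) = \<Sum>\<^sub>i (-\<eta>)\<^sup>i t^e\<^sub>m\<^sub>+\<^sub>i\<close> and \<open>\<eta>\<close> is an eigenvalue of \<open>b\<close>.
Since \<open>det (\<Phi>(x) - 1) = det (\<Phi>(y) - 1) = 1 - t\<^sup>2\<close>, the twisted Alexander polynomial times \<open>(t\<^sup>2 - 1)\<^sup>2\<close> is
\<open>S(t) S(-t)\<close>. The root of unity \<open>\<eta>\<close> makes \<open>S\<close> vanish at \<open>t = 1\<close> and \<open>t = -1\<close>, so
\<open>S = (t\<^sup>2 - 1) Q\<close> and the twisted Alexander polynomial is \<open>Q(t) Q(-t)\<close> up to a unit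
(\<open>twisted_alexander_factorization\<close>).

By the symmetry of \<open>e\<close> the powers of \<open>\<eta>\<close> occur in \<open>Q\<close> only through sums \<open>\<eta>\<^sup>i + \<eta>\<^sup>-\<^sup>i\<close>, which are integer
polynomials in \<open>\<omega>\<close> (\<open>poly_generic_factor\<close>). The product of \<open>Q\<close> over the roots \<open>\<omega>\<close> of the monic
polynomial \<open>\<theta>\<^sub>n\<close> is therefore an integer polynomial \<open>f\<close>, and the total twisted Alexander polynomial is
\<open>f(t) f(-t)\<close> over \<open>\<int>\<close>. Modulo \<open>p\<close> the polynomial \<open>\<theta>\<^sub>n(z)\<close> is \<open>z\<^sup>n\<close>, so \<open>f\<close> is congruent to the \<open>n\<close>-th power of
the value of \<open>Q\<close> at \<open>\<omega> = 0\<close> (\<open>prod_over_roots_in_image\<close>, \<open>integral_total_factor\<close>). At \<open>\<omega> = 0\<close> the sum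
\<open>S\<close> becomes the abelianization of \<open>(x - 1) \<partial>R/\<partial>x\<close>, which is \<open>(t - 1) \<Delta>\<close> up to a unit; dividing by
\<open>t\<^sup>2 - 1\<close> leaves \<open>\<Delta> / (1 + t)\<close> modulo \<open>p\<close>. The same computation gives \<open>\<Delta>(-1) = \<plusminus>\<alpha>\<close>, so the hypothesis on
\<open>\<Delta>(-1)\<close> says \<open>p dvd \<alpha>\<close>, which is what makes \<open>\<eta>\<close> compatible with the period \<open>2\<alpha>\<close>
(\<open>fox_abelianized_alexander_poly\<close>, \<open>alexander_polynomial_eq_units\<close>).\<close>

section \<open>Matrices\<close>

definition mat22 :: "'a::zero \<Rightarrow> 'a \<Rightarrow> 'a \<Rightarrow> 'a \<Rightarrow> 'a^2^2" where
  "mat22 p q r s = vector [vector [p, q], vector [r, s]]"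

lemma mat22_nth [simp]:
  "mat22 p q r s $ 1 $ 1 = p" "mat22 p q r s $ 1 $ 2 = q"
  "mat22 p q r s $ 2 $ 1 = r" "mat22 p q r s $ 2 $ 2 = s"
  by (simp_all add: mat22_def vector_2)

lemma mat22_eqI: "A $ 1 $ 1 = p \<Longrightarrow> A $ 1 $ 2 = q \<Longrightarrow> A $ 2 $ 1 = r \<Longrightarrow> A $ 2 $ 2 = s \<Longrightarrow> A = mat22 p q r s"
  by (simp add: vec_eq_iff forall_2)

lemma mat22_mult:
  "mat22 p q r s ** mat22 p' q' r' s' =
     mat22 (p * p' + q * r' :: 'a::comm_ring_1) (p * q' + q * s') (r * p' + s * r') (r * q' + s * s')"
  by (rule mat22_eqI) (simp_all add: matrix_matrix_mult_def sum_2)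

lemma mat22_add: "mat22 p q r s + mat22 p' q' r' s' = mat22 (p + p' :: 'a::comm_ring_1) (q + q') (r + r') (s + s')"
  by (rule mat22_eqI) simp_all

lemma mat22_diff: "mat22 p q r s - mat22 p' q' r' s' = mat22 (p - p' :: 'a::comm_ring_1) (q - q') (r - r') (s - s')"
  by (rule mat22_eqI) simp_all

lemma mat22_one: "Finite_Cartesian_Product.mat 1 = mat22 (1 :: 'a::comm_ring_1) 0 0 1"
  by (rule mat22_eqI) (simp_all add: mat_def)

lemma mat22_zero: "0 = mat22 (0 :: 'a::comm_ring_1) 0 0 0"
  by (rule mat22_eqI) simp_all

lemma det_mat22: "Determinants.det (mat22 p q r s) = (p * s - q * r :: 'a::comm_ring_1)"
  by (simp add: det_2)

lemma mat22_cong: "p = p' \<Longrightarrow> q = q' \<Longrightarrow> r = r' \<Longrightarrow> s = s' \<Longrightarrow> mat22 p q r s = mat22 p' q' r' s'"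
  by simp

lemma matrix_mult_diff_right: "A ** (B - C) = A ** B - A ** (C :: 'a::comm_ring_1^'n^'m)"
  by (vector matrix_matrix_mult_def sum_subtractf [symmetric] field_simps)

lemma matrix_mult_minus_left: "(- A) ** B = - (A ** (B :: 'a::comm_ring_1^'n^'m))"
  by (simp add: vec_eq_iff matrix_matrix_mult_def sum_negf)

lemma matrix_mult_add_left: "(A + B) ** C = A ** C + B ** (C :: 'a::comm_ring_1^'n^'m)"
  by (simp add: vec_eq_iff matrix_matrix_mult_def sum.distrib distrib_right)

lemma matrix_mult_diff_left: "(A - B) ** C = A ** C - B ** (C :: 'a::comm_ring_1^'n^'m)"
  by (simp add: vec_eq_iff matrix_matrix_mult_def sum_subtractf left_diff_distrib)

lemma matrix_inv_eqI:
  assumes "A ** B = Finite_Cartesian_Product.mat 1" "B ** A = Finite_Cartesian_Product.mat (1 :: 'a::comm_ring_1)"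
  shows "matrix_inv A = B"
proof -
  have "A ** matrix_inv A = Finite_Cartesian_Product.mat 1 \<and> matrix_inv A ** A = Finite_Cartesian_Product.mat 1"
    unfolding matrix_inv_def using assms by (intro someI[of "\<lambda>C. A ** C = Finite_Cartesian_Product.mat 1 \<and> C ** A = Finite_Cartesian_Product.mat 1"]) simp
  then show ?thesis
    using assms by (metis matrix_mul_assoc matrix_mul_lid matrix_mul_rid)
qed

section \<open>The relator as an alternating word\<close>

text \<open>The sign of the \<open>j\<close>-th letter of the relator. Shifting \<open>j b\<close> by one makes a single rule
  cover also the letters \<open>x\<close> at \<open>j = a\<close> and \<open>y\<^sup>-\<^sup>1\<close> at \<open>j = 2 a\<close>, where \<open>j b\<close> is divisible by \<open>a\<close>.\<close>

definition positive_letter :: "nat \<Rightarrow> nat \<Rightarrow> nat \<Rightarrow> bool" where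
  "positive_letter a b j \<longleftrightarrow> even ((int j * int b - 1) div int a)"

text \<open>For even \<open>b\<close>, replacing \<open>b\<close> by \<open>a + b\<close> adds \<open>j\<close> to \<open>\<lfloor>j b / a\<rfloor>\<close>, which is the extra
  sign in the definition of \<open>eps\<close>; so only odd slopes have to be considered.\<close>

definition odd_slope :: "nat \<Rightarrow> nat \<Rightarrow> nat" where
  "odd_slope a b = (if odd b then b else a + b)"

definition alternating_word :: "(nat \<Rightarrow> bool) \<Rightarrow> nat \<Rightarrow> gen word" where
  "alternating_word s N = map (\<lambda>j. (if odd j then X else Y, s j)) [1..<Suc N]"

text \<open>The power of \<open>t\<close> to which \<open>\<Phi>\<close> sends the prefix of length \<open>N\<close> of an alternating word with signs
  \<open>s\<close>.\<close>

primrec height :: "(nat \<Rightarrow> bool) \<Rightarrow> nat \<Rightarrow> int" where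
  "height s 0 = 0"
| "height s (Suc N) = height s N + (if s (Suc N) then 1 else -1)"

lemma alternating_word_0 [simp]: "alternating_word s 0 = []"
  by (simp add: alternating_word_def)

lemma alternating_word_Suc:
  "alternating_word s (Suc N) = alternating_word s N @ [(if odd (Suc N) then X else Y, s (Suc N))]"
  by (simp add: alternating_word_def)

lemma even_height: "even (height s N) \<longleftrightarrow> even N"
  by (induction N) auto

lemma abs_height_le: "\<bar>height s N\<bar> \<le> int N"
  by (induction N) auto

lemma div_pred_not_dvd:
  fixes x a :: int
  assumes "0 < a" "\<not> a dvd x"
  shows "(x - 1) div a = x div a"
proof -
  have "x mod a > 0" using assms
    by (metis mod_0_imp_dvd order_le_less pos_mod_sign)
  then have "x - 1 = a * (x div a) + (x mod a - 1)" "0 \<le> x mod a - 1" "x mod a - 1 < a"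
    using assms pos_mod_bound[of a x] mult_div_mod_eq[of a x] by linarith+
  then show ?thesis
    by (metis assms(1) div_mult_self4 div_pos_pos_trivial add.commute add_0 less_irrefl)
qed

lemma div_minus_pred:
  fixes x a :: int
  assumes "0 < a"
  shows "(- x) div a = - ((x - 1) div a) - 1"
proof -
  define q r where "q = (x - 1) div a" and "r = (x - 1) mod a"
  have r: "0 \<le> r" "r < a" "x - 1 = a * q + r"
    using assms by (simp_all add: q_def r_def)
  have "- x = (a - 1 - r) + a * (- q - 1)"
    using r(3) by (simp add: algebra_simps)
  then have "(- x) div a = ((a - 1 - r) + a * (- q - 1)) div a"
    by (rule arg_cong)
  also have "\<dots> = (- q - 1) + (a - 1 - r) div a"
    by (rule div_mult_self2) (use assms in simp)
  also have "(a - 1 - r) div a = 0"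
    using r by (simp add: div_pos_pos_trivial)
  finally show ?thesis by (simp add: q_def)
qed

lemma div_eq_plus_div:
  fixes x y k a :: int
  assumes "x = y + k * a" "0 < a"
  shows "x div a = k + y div a"
  using assms by (simp add: div_mult_self1)

lemma positive_letter_shift:
  assumes "0 < a" "odd b"
  shows "positive_letter a b (j + a) \<longleftrightarrow> \<not> positive_letter a b j"
proof -
  have "int (j + a) * int b - 1 = (int j * int b - 1) + int b * int a"
    by (simp add: algebra_simps)
  then have "(int (j + a) * int b - 1) div int a = int b + (int j * int b - 1) div int a"
    using assms by (intro div_eq_plus_div) simp_all
  then show ?thesis
    using assms by (simp add: positive_letter_def)
qed

text \<open>If \<open>i + j\<close> is \<open>c\<close> modulo \<open>2 a\<close> then \<open>j b = 1 - i b\<close>, and reflecting a residue about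
  one half exchanges the two halves of \<open>\<int>/2a\<close>.\<close>

lemma positive_letter_reflect:
  assumes "0 < a" "odd b" and c: "[c * b = 1] (mod (2 * a))"
    and "i + j = c + 2 * a"
  shows "positive_letter a b j \<longleftrightarrow> \<not> positive_letter a b i"
proof -
  have "[int c * int b = 1] (mod (2 * int a))"
    using c by (metis cong_int_iff of_nat_1 of_nat_mult of_nat_numeral)
  then obtain k where k: "int c * int b = 2 * int a * k + 1"
    by (metis cong_iff_lin cong_sym add.commute)
  have j: "int j = int c + 2 * int a - int i"
    using assms(4) by linarith
  have "int j * int b - 1 = (int c * int b - 1) + 2 * int a * int b - int i * int b"
    unfolding j by (simp add: algebra_simps)
  also have "\<dots> = - (int i * int b) + (2 * (k + int b)) * int a"
    unfolding k by (simp add: algebra_simps)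
  finally have "(int j * int b - 1) div int a = 2 * (k + int b) + (- (int i * int b)) div int a"
    using assms(1) by (intro div_eq_plus_div) simp_all
  also have "\<dots> = - ((int i * int b - 1) div int a) - 1 + 2 * (k + int b)"
    using div_minus_pred[of "int a" "int i * int b"] assms(1) by simp
  finally have "(int j * int b - 1) div int a = - ((int i * int b - 1) div int a) - 1 + 2 * (k + int b)" .
  moreover have "even x \<longleftrightarrow> odd y" if "x = - y - 1 + 2 * z" for x y z :: int
    using that by presburger
  ultimately show ?thesis
    unfolding positive_letter_def by blast
qed

lemma odd_odd_slope: "odd a \<Longrightarrow> odd (odd_slope a b)"
  by (simp add: odd_slope_def)

lemma coprime_odd_slope: "coprime a b \<Longrightarrow> coprime a (odd_slope a b)"
  by (simp add: odd_slope_def coprime_iff_gcd_eq_1)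

lemma eps_iff_positive_letter:
  assumes "two_bridge a b" "0 < j" "j < a"
  shows "eps a b j = 1 \<longleftrightarrow> positive_letter a (odd_slope a b) j"
proof -
  have a: "0 < a" "odd a" and cop: "coprime a (odd_slope a b)"
    using assms(1) coprime_odd_slope[of a b] by (simp_all add: two_bridge_def)
  have "\<not> a dvd j * odd_slope a b"
    using cop assms by (metis coprime_dvd_mult_left_iff nat_dvd_not_less)
  then have nd: "\<not> int a dvd int j * int (odd_slope a b)"
    by (metis int_dvd_int_iff of_nat_mult)
  have "positive_letter a (odd_slope a b) j \<longleftrightarrow> even (j * odd_slope a b div a)"
    unfolding positive_letter_def using div_pred_not_dvd[OF _ nd] a(1)
    by (simp flip: of_nat_mult zdiv_int)
  moreover have "eps a b j = (-1) ^ (j * odd_slope a b div a)"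
  proof (cases "odd b")
    case False
    then have "j * odd_slope a b div a = j * b div a + j"
      using a by (simp add: odd_slope_def distrib_left)
    then show ?thesis using False by (simp add: eps_def)
  qed (simp add: eps_def odd_slope_def)
  ultimately show ?thesis by (simp add: minus_one_power_iff)
qed

text \<open>Inverting the first half of the relator reverses its order, and
  \<open>j \<mapsto> 2 a - j\<close> preserves the parity of \<open>j\<close> and negates the residue \<open>j b\<close>; so the second half
  obeys the same rule as the first.\<close>

lemma knot_R_eq_alternating_word:
  assumes "two_bridge a b"
  shows "knot_R a b = alternating_word (positive_letter a (odd_slope a b)) (2 * a)"
proof -
  define c s where "c = odd_slope a b" and "s = positive_letter a c"
  define l where "l = (\<lambda>j. (if odd j then X else Y, s j))"
  have a: "0 < a" "odd a" and cop: "coprime a c" and c: "odd c"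
    using assms coprime_odd_slope[of a b] odd_odd_slope[of a b] by (simp_all add: two_bridge_def c_def)
  have W: "knot_W a b = map l [1..<a]"
    unfolding knot_W_def l_def s_def c_def using eps_iff_positive_letter[OF assms]
    by (intro map_cong) auto
  have reflect: "s (2 * a - j) \<longleftrightarrow> \<not> s j" if "0 < j" "j < a" for j
  proof -
    have "\<not> a dvd j * c"
      using cop that by (metis coprime_dvd_mult_left_iff nat_dvd_not_less)
    then have nd: "\<not> int a dvd int j * int c"
      by (metis int_dvd_int_iff of_nat_mult)
    have "int (2 * a - j) * int c - 1 = - (int j * int c + 1) + (2 * int c) * int a"
      using that by (simp add: of_nat_diff algebra_simps)
    then have "(int (2 * a - j) * int c - 1) div int a = 2 * int c + (- (int j * int c + 1)) div int a"
      using a by (intro div_eq_plus_div) simp_all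
    also have "(- (int j * int c + 1)) div int a = - ((int j * int c) div int a) - 1"
      using a div_minus_pred[of "int a" "int j * int c + 1"] by simp
    also have "(int j * int c) div int a = (int j * int c - 1) div int a"
      using div_pred_not_dvd[OF _ nd] a by simp
    finally show ?thesis by (simp add: s_def positive_letter_def)
  qed
  have s_a: "s a"
  proof -
    have "int a * int c - 1 = -1 + int c * int a" by simp
    then have "(int a * int c - 1) div int a = int c + (-1) div int a"
      using a by (intro div_eq_plus_div) simp_all
    also have "(-1) div int a = -1"
      using a by (simp add: div_eq_minus1)
    finally show ?thesis using c by (simp add: s_def positive_letter_def)
  qed
  have s_2a: "\<not> s (2 * a)"
    using positive_letter_shift[OF a(1) c, of a] s_a by (simp add: s_def mult_2)
  have inv: "inv_word (map l [1..<a]) = map l [Suc a..<2 * a]"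
  proof (rule nth_equalityI)
    show "length (inv_word (map l [1..<a])) = length (map l [Suc a..<2 * a])"
      by (simp add: inv_word_def)
    fix i assume "i < length (inv_word (map l [1..<a]))"
    then have i: "i < a - 1" by (simp add: inv_word_def)
    have "inv_word (map l [1..<a]) ! i = (\<lambda>(g, b). (g, \<not> b)) (l (a - 1 - i))"
    proof -
      have "1 + (a - 1 - Suc i) = a - 1 - i"
        using i by linarith
      then show ?thesis
        using i by (simp add: inv_word_def rev_nth nth_append del: upt_Suc)
    qed
    also have "\<dots> = l (2 * a - (a - 1 - i))"
      using reflect[of "a - 1 - i"] i by (simp add: l_def) presburger
    also have "2 * a - (a - 1 - i) = Suc a + i" using i by linarith
    finally show "inv_word (map l [1..<a]) ! i = map l [Suc a..<2 * a] ! i"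
      using i by simp
  qed
  have "[1..<Suc (2 * a)] = [1..<a] @ [a..<Suc (2 * a)]"
    using a upt_add_eq_append[of 1 a "Suc a"] by (simp add: mult_2)
  also have "[a..<Suc (2 * a)] = a # [Suc a..<2 * a] @ [2 * a]"
    using a by (simp add: upt_conv_Cons)
  finally have "alternating_word s (2 * a) = map l [1..<a] @ [l a] @ map l [Suc a..<2 * a] @ [l (2 * a)]"
    by (simp add: alternating_word_def l_def del: upt_Suc)
  moreover have "l a = (X, True)" "l (2 * a) = (Y, False)"
    using a s_a s_2a by (auto simp: l_def)
  ultimately show ?thesis
    unfolding knot_R_def W inv by (simp add: s_def c_def)
qed

section \<open>Symmetries of the height function\<close>

text \<open>These are the only two properties of the signs that are used below. In the second one, letters
  at opposite positions about \<open>m + 1/2\<close> have opposite signs, the positions being read modulo \<open>2 a\<close>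
  and written with the representatives that sum to \<open>2 m + 1 + 2 a\<close>.\<close>

definition antiperiodic :: "(nat \<Rightarrow> bool) \<Rightarrow> nat \<Rightarrow> bool" where
  "antiperiodic s a \<longleftrightarrow> (\<forall>j. s (j + a) \<longleftrightarrow> \<not> s j)"

definition skew_symmetric :: "(nat \<Rightarrow> bool) \<Rightarrow> nat \<Rightarrow> nat \<Rightarrow> bool" where
  "skew_symmetric s a m \<longleftrightarrow> (\<forall>i j. i + j = 2 * m + 1 + 2 * a \<longrightarrow> (s j \<longleftrightarrow> \<not> s i))"

lemma height_shift_half_period:
  assumes "antiperiodic s a"
  shows "height s (j + a) = height s a - height s j"
proof (induction j)
  case (Suc j)
  have "s (Suc j + a) \<longleftrightarrow> \<not> s (Suc j)"
    using assms unfolding antiperiodic_def by blast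
  then show ?case using Suc by simp
qed simp

lemma height_period:
  assumes "antiperiodic s a"
  shows "height s (2 * a) = 0" "height s (j + 2 * a) = height s j"
proof -
  note * = height_shift_half_period[OF assms]
  show "height s (2 * a) = 0" using *[of a] by (simp add: mult_2)
  show "height s (j + 2 * a) = height s j"
    using *[of j] *[of "j + a"] by (simp add: mult_2 add.assoc)
qed

text \<open>Walking from \<open>m\<close> to the right, and to the left from the translate \<open>m + 2 a\<close> of \<open>m\<close>, one meets
  letters at opposite positions, so both walks change the height in the same way.\<close>

lemma height_symmetric:
  assumes "antiperiodic s a" "skew_symmetric s a m" "i \<le> 2 * a"
  shows "height s (m + (2 * a - i)) = height s (m + i)"
  using assms(3)
proof (induction i)
  case 0
  then show ?case using height_period(2)[OF assms(1), of m] by simp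
next
  case (Suc i)
  have *: "m + (2 * a - i) = Suc (m + (2 * a - Suc i))"
    using Suc.prems by simp
  have "Suc (m + i) + Suc (m + (2 * a - Suc i)) = 2 * m + 1 + 2 * a"
    using Suc.prems by simp
  then have "s (Suc (m + (2 * a - Suc i))) \<longleftrightarrow> \<not> s (Suc (m + i))"
    using assms(2) unfolding skew_symmetric_def by blast
  then show ?case
    using Suc.IH Suc.prems unfolding * by (simp split: if_splits)
qed

lemma antiperiodic_positive_letter:
  "0 < a \<Longrightarrow> odd b \<Longrightarrow> antiperiodic (positive_letter a b) a"
  by (simp add: antiperiodic_def positive_letter_shift)

lemma skew_symmetric_positive_letter:
  assumes "odd a" "odd b" "coprime a b"
  obtains m where "skew_symmetric (positive_letter a b) a m"
proof -
  have "coprime b (2 * a)"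
    using assms by (simp add: coprime_commute)
  then obtain c where c: "[b * c = 1] (mod (2 * a))"
    using cong_solve_coprime_nat[of b "2 * a"] by auto
  \<comment> \<open>The centre of symmetry \<open>(c - 1) / 2\<close> is an index because \<open>c\<close> inverts an odd number modulo
    an even one.\<close>
  have "odd c"
  proof
    assume "even c"
    have "[b * c = 1] (mod 2)"
      using c cong_dvd_modulus_nat dvd_triv_left by blast
    then show False using \<open>even c\<close> by (simp add: cong_def mod2_eq_if)
  qed
  then obtain m where "c = 2 * m + 1" by (elim oddE)
  with c have "[(2 * m + 1) * b = 1] (mod (2 * a))" by (simp add: mult.commute)
  moreover have "0 < a" using assms(1) by (simp add: odd_pos)
  ultimately have "skew_symmetric (positive_letter a b) a m"
    using positive_letter_reflect[of a b] assms(2) unfolding skew_symmetric_def by blast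
  then show ?thesis by (rule that)
qed

section \<open>Fox calculus along the relator\<close>

lemma fox_snoc:
  "fox g (u @ [(h, b)]) =
     fox g u @ (if h = g then [if b then (1, u) else (-1, u @ [(h, False)])] else [])"
  by (induction u rule: fox.induct) auto

lemma Phi_word_append: "Phi_word \<sigma> (u @ v) = Phi_word \<sigma> u ** Phi_word \<sigma> v"
  by (induction \<sigma> u rule: Phi_word.induct) (auto simp: matrix_mul_assoc matrix_mul_lid)

lemma Phi_append: "Phi \<sigma> (s @ s') = Phi \<sigma> s + Phi \<sigma> s'"
  by (simp add: Phi_def)

text \<open>Multiplying by \<open>\<Phi>(g) - 1\<close> turns the Fox derivative into a sum of differences of prefixes,
  because both \<open>g\<close> and \<open>g\<^sup>-\<^sup>1\<close> then contribute the prefix after the letter minus the prefix before.\<close>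

lemma Phi_fox_snoc:
  fixes \<sigma> :: "gen \<Rightarrow> 'a::idom^'m^'m"
  assumes inv: "matrix_inv (Phi_gen \<sigma> g) ** Phi_gen \<sigma> g = Finite_Cartesian_Product.mat 1"
  shows "Phi \<sigma> (fox g (u @ [(h, b)])) ** (Phi_gen \<sigma> g - Finite_Cartesian_Product.mat 1) =
           Phi \<sigma> (fox g u) ** (Phi_gen \<sigma> g - Finite_Cartesian_Product.mat 1) +
           (if h = g then Phi_word \<sigma> (u @ [(h, b)]) - Phi_word \<sigma> u else 0)"
proof -
  have 1: "Phi \<sigma> [(1, u)] = Phi_word \<sigma> u"
    by (simp add: Phi_def matrix_mul_lid)
  have 2: "Phi \<sigma> [(-1, w)] = - Phi_word \<sigma> w" for w
    by (simp add: Phi_def vec_eq_iff matrix_matrix_mult_def mat_def if_distrib if_distribR sum.delta cong: if_cong)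
  have 3: "- (Phi_word \<sigma> u ** matrix_inv (Phi_gen \<sigma> g)) ** (Phi_gen \<sigma> g - Finite_Cartesian_Product.mat 1) =
      Phi_word \<sigma> u ** matrix_inv (Phi_gen \<sigma> g) - Phi_word \<sigma> u"
    by (simp add: matrix_mult_minus_left matrix_mult_diff_right matrix_mul_rid inv flip: matrix_mul_assoc)
  have 0: "Phi \<sigma> [] = 0"
    by (simp add: Phi_def)
  have inv': "(A ** matrix_inv (Phi_gen \<sigma> g)) ** Phi_gen \<sigma> g = A" for A :: "'a poly fract^'m^'m"
    by (simp add: inv matrix_mul_rid flip: matrix_mul_assoc)
  show ?thesis
    by (auto simp: fox_snoc Phi_append 0 1 2 inv' matrix_mult_minus_left Phi_word_append matrix_mult_add_left 3 matrix_mul_rid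
        matrix_mult_diff_right)
qed

lemma to_fract_const_one: "to_fract [:1:] = 1" "to_fract [:- 1 :: 'a::idom:] = - 1"
proof -
  show "to_fract [:1:] = 1" by (simp flip: one_pCons)
  have "[:- 1:] = (- 1 :: 'a poly)" by (simp add: one_pCons)
  then show "to_fract [:- 1 :: 'a:] = - 1" by simp
qed

lemma Phi_gen_tau_X: "Phi_gen (tau \<omega>) X = mat22 (- tvar) tvar 0 tvar"
  by (rule mat22_eqI) (simp_all add: Phi_gen_def vector_2 to_fract_const_one)

lemma Phi_gen_tau_Y: "Phi_gen (tau \<omega>) Y = mat22 (- tvar) 0 (to_fract [:\<omega>:] * tvar) tvar"
  by (rule mat22_eqI) (simp_all add: Phi_gen_def vector_2 to_fract_const_one)

lemma tvar_nonzero [simp]: "tvar \<noteq> (0 :: 'a::idom poly fract)"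
  by (simp add: tvar_def)

text \<open>The generators of the dihedral group act as reflections, so their inverses in the matrix
  group over the Laurent polynomials differ from them only in the power of \<open>t\<close>.\<close>

lemma matrix_inv_reflection_X:
  fixes t :: "'a::field"
  assumes "t \<noteq> 0"
  shows "matrix_inv (mat22 (- t) t 0 t) = mat22 (- inverse t) (inverse t) 0 (inverse t)"
  using assms by (intro matrix_inv_eqI) (simp_all add: mat22_mult mat22_one)

lemma matrix_inv_reflection_Y:
  fixes t w :: "'a::field"
  assumes "t \<noteq> 0"
  shows "matrix_inv (mat22 (- t) 0 (w * t) t) = mat22 (- inverse t) 0 (w * inverse t) (inverse t)"
  using assms by (intro matrix_inv_eqI) (simp_all add: mat22_mult mat22_one)

text \<open>The columns are eigenvectors of \<open>\<xi>(xy)\<close> for the eigenvalues \<open>x\<^sup>2\<close> and \<open>x\<^sup>-\<^sup>2\<close>, where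
  \<open>x\<^sup>2 + x\<^sup>-\<^sup>2 - 2 = \<omega>\<close>. They are scaled so that both generators exchange them up to the factors
  \<open>x\<^sup>\<plusminus>\<^sup>1\<close>.\<close>

definition eigenbasis :: "'a::field \<Rightarrow> 'a^2^2" where
  "eigenbasis x = mat22 1 (- inverse x) (1 - inverse x ^ 2) (x - inverse x)"

text \<open>The matrix \<open>b\<^sup>N h\<^sup>N t\<^sup>e\<close> with \<open>b = diag(x, x\<^sup>-\<^sup>1)\<close>, \<open>h\<close> the exchange of the two basis vectors and
  \<open>e\<close> the height.\<close>

definition dihedral_prefix :: "(nat \<Rightarrow> bool) \<Rightarrow> 'a::field \<Rightarrow> 'a \<Rightarrow> nat \<Rightarrow> 'a^2^2" where
  "dihedral_prefix s x t N =
     (if even N then mat22 (x ^ N * t powi height s N) 0 0 (inverse x ^ N * t powi height s N)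
      else mat22 0 (x ^ N * t powi height s N) (inverse x ^ N * t powi height s N) 0)"

lemma reflection_X_eigenbasis:
  fixes x t :: "'a::field"
  assumes "x \<noteq> 0"
  shows "mat22 (- t) t 0 t ** eigenbasis x = eigenbasis x ** mat22 0 (x * t) (inverse x * t) 0"
  unfolding eigenbasis_def mat22_mult using assms
  by (intro mat22_cong) (simp_all add: field_simps power2_eq_square)

lemma reflection_Y_eigenbasis:
  fixes x t w :: "'a::field"
  assumes "x \<noteq> 0" and w: "w = x ^ 2 + inverse x ^ 2 - 2"
  shows "mat22 (- t) 0 (w * t) t ** eigenbasis x = eigenbasis x ** mat22 0 (inverse x * t) (x * t) 0"
  unfolding eigenbasis_def mat22_mult w using assms(1)
  by (intro mat22_cong) (simp_all add: field_simps power2_eq_square)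

text \<open>In the eigenbasis the letters at odd and even positions are \<open>b h\<close> and \<open>h b\<close> up to powers
  of \<open>t\<close>, irrespective of their signs, and \<open>h b h = b\<^sup>-\<^sup>1\<close>.\<close>

lemma Phi_word_alternating:
  assumes "x \<noteq> 0" and w: "to_fract [:\<omega>:] = x ^ 2 + inverse x ^ 2 - 2"
  shows "Phi_word (tau \<omega>) (alternating_word s N) ** eigenbasis x =
           eigenbasis x ** dihedral_prefix s x tvar N"
proof (induction N)
  case 0
  then show ?case
    by (simp add: dihedral_prefix_def matrix_mul_lid matrix_mul_rid flip: mat22_one)
next
  case (Suc N)
  let ?e = "if s (Suc N) then 1 else (-1 :: int)"
  let ?g = "if odd (Suc N) then X else Y"
  let ?L = "Phi_word (tau \<omega>) [(?g, s (Suc N))]"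
  let ?S = "if odd (Suc N) then mat22 0 (x * tvar powi ?e) (inverse x * tvar powi ?e) 0
            else mat22 0 (inverse x * tvar powi ?e) (x * tvar powi ?e) 0"
  have L: "?L ** eigenbasis x = eigenbasis x ** ?S"
    using reflection_X_eigenbasis[OF assms(1)] reflection_Y_eigenbasis[OF assms(1) w]
    by (auto simp: Phi_gen_tau_X Phi_gen_tau_Y matrix_inv_reflection_X matrix_inv_reflection_Y
        matrix_mul_rid power_int_minus)
  have D: "dihedral_prefix s x tvar N ** ?S = dihedral_prefix s x tvar (Suc N)"
    using assms(1) by (auto simp: dihedral_prefix_def mat22_mult power_int_add mult_ac)
  have "Phi_word (tau \<omega>) (alternating_word s (Suc N)) ** eigenbasis x =
      Phi_word (tau \<omega>) (alternating_word s N) ** (?L ** eigenbasis x)"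
    by (simp only: alternating_word_Suc Phi_word_append matrix_mul_assoc)
  also have "\<dots> = eigenbasis x ** (dihedral_prefix s x tvar N ** ?S)"
    unfolding L matrix_mul_assoc Suc.IH ..
  finally show ?case unfolding D .
qed

definition prefix_sum :: "(nat \<Rightarrow> bool) \<Rightarrow> (nat \<Rightarrow> bool) \<Rightarrow> 'a::field \<Rightarrow> 'a \<Rightarrow> nat \<Rightarrow> 'a" where
  "prefix_sum P s x t N = (\<Sum>j<N. if P j then x ^ j * t powi height s j else 0)"

text \<open>The letters \<open>x\<^sup>\<plusminus>\<^sup>1\<close> stand at the odd positions, so the differences of consecutive
  prefixes combine to an alternating sum over all prefixes of length less than \<open>2 k\<close>. Even prefixes
  are diagonal and odd ones antidiagonal.\<close>

lemma Phi_fox_alternating: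
  assumes "x \<noteq> 0" and w: "to_fract [:\<omega>:] = x ^ 2 + inverse x ^ 2 - 2"
  shows "(Phi (tau \<omega>) (fox X (alternating_word s (2 * k))) ** (Phi_gen (tau \<omega>) X - Finite_Cartesian_Product.mat 1)) ** eigenbasis x =
     eigenbasis x **
       mat22 (- prefix_sum even s x tvar (2 * k)) (prefix_sum odd s x tvar (2 * k))
             (prefix_sum odd s (inverse x) tvar (2 * k)) (- prefix_sum even s (inverse x) tvar (2 * k))"
    (is "?T k ** ?U = ?U ** ?M k")
proof (induction k)
  case 0
  then show ?case by (simp add: Phi_def prefix_sum_def flip: mat22_zero)
next
  case (Suc k)
  have inv: "matrix_inv (Phi_gen (tau \<omega>) X) ** Phi_gen (tau \<omega>) X = Finite_Cartesian_Product.mat 1"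
    by (simp add: Phi_gen_tau_X matrix_inv_reflection_X mat22_mult mat22_one)
  let ?W = "\<lambda>N. Phi_word (tau \<omega>) (alternating_word s N)"
  let ?D = "dihedral_prefix s x tvar"
  have "?T (Suc k) = ?T k + (?W (Suc (2 * k)) - ?W (2 * k))"
  proof -
    have step: "Phi (tau \<omega>) (fox X (alternating_word s (Suc N))) ** (Phi_gen (tau \<omega>) X - Finite_Cartesian_Product.mat 1) =
        Phi (tau \<omega>) (fox X (alternating_word s N)) ** (Phi_gen (tau \<omega>) X - Finite_Cartesian_Product.mat 1) +
        (if odd (Suc N) then ?W (Suc N) - ?W N else 0)" for N
      unfolding alternating_word_Suc Phi_fox_snoc[OF inv] by simp
    show ?thesis using step[of "2 * k"] step[of "Suc (2 * k)"] by simp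
  qed
  then have "?T (Suc k) ** ?U = ?U ** ?M k + (?U ** ?D (Suc (2 * k)) - ?U ** ?D (2 * k))"
    using Suc.IH Phi_word_alternating[OF assms]
    by (simp add: matrix_mult_add_left matrix_mult_diff_left)
  also have "\<dots> = ?U ** (?M k + (?D (Suc (2 * k)) - ?D (2 * k)))"
    by (simp add: matrix_mult_diff_right matrix_add_ldistrib)
  also have "?M k + (?D (Suc (2 * k)) - ?D (2 * k)) = ?M (Suc k)"
    by (simp add: dihedral_prefix_def mat22_diff mat22_add prefix_sum_def)
  finally show ?case .
qed

text \<open>The determinants of \<open>\<Phi>(x) - 1\<close> and \<open>\<Phi>(y) - 1\<close> are both \<open>1 - t\<^sup>2\<close>. The assumption on \<open>x ^ 4\<close>
  makes the eigenbasis a basis.\<close>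

lemma twisted_alexander_alternating:
  assumes "x \<noteq> 0" "x ^ 4 \<noteq> 1" and w: "to_fract [:\<omega>:] = x ^ 2 + inverse x ^ 2 - 2"
    and R: "knot_R \<alpha> \<beta> = alternating_word s (2 * k)"
  shows "twisted_alexander \<alpha> \<beta> (tau \<omega>) * (tvar ^ 2 - 1) ^ 2 =
     prefix_sum even s x tvar (2 * k) * prefix_sum even s (inverse x) tvar (2 * k) -
     prefix_sum odd s x tvar (2 * k) * prefix_sum odd s (inverse x) tvar (2 * k)"
    (is "_ = ?d")
proof -
  let ?A = "Phi (tau \<omega>) (fox X (knot_R \<alpha> \<beta>))"
  have t: "tvar ^ 2 - 1 \<noteq> (0 :: complex poly fract)"
  proof -
    have "tvar ^ 2 - 1 = to_fract ([:0, 1:] ^ 2 - 1 :: complex poly)"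
      by (simp only: tvar_def power2_eq_square to_fract_mult to_fract_diff to_fract_1)
    moreover have "[:0, 1:] ^ 2 - 1 \<noteq> (0 :: complex poly)"
      by (simp add: power2_eq_square one_pCons)
    ultimately show ?thesis by (simp only: to_fract_eq_0_iff not_False_eq_True)
  qed
  have dU: "Determinants.det (eigenbasis x) \<noteq> 0"
  proof
    assume "Determinants.det (eigenbasis x) = 0"
    then have "x ^ 4 = 1"
      using assms(1) by (simp add: eigenbasis_def det_mat22 field_simps power_numeral_reduce)
    with assms(2) show False by simp
  qed
  have "Determinants.det (?A ** (Phi_gen (tau \<omega>) X - Finite_Cartesian_Product.mat 1)) * Determinants.det (eigenbasis x) = Determinants.det (eigenbasis x) * ?d"
    using arg_cong[OF Phi_fox_alternating[OF assms(1) w, of s k], of Determinants.det]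
    by (simp add: det_mul det_mat22 R)
  then have "Determinants.det (?A ** (Phi_gen (tau \<omega>) X - Finite_Cartesian_Product.mat 1)) = ?d"
    using dU by (simp add: mult.commute)
  moreover have "Determinants.det (Phi_gen (tau \<omega>) X - Finite_Cartesian_Product.mat 1) = 1 - tvar ^ 2"
    by (simp add: Phi_gen_tau_X mat22_one mat22_diff det_mat22 power2_eq_square algebra_simps)
  moreover have "Determinants.det (Phi (tau \<omega>) [(1, [(Y, True)]), (-1, [])]) = 1 - tvar ^ 2"
  proof -
    have "Phi (tau \<omega>) [(1, [(Y, True)]), (-1, [])] = Phi_gen (tau \<omega>) Y - Finite_Cartesian_Product.mat 1"
    proof -
      have "Finite_Cartesian_Product.mat (of_int (- 1)) = - (Finite_Cartesian_Product.mat 1 :: complex poly fract^2^2)"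
        by (simp add: vec_eq_iff mat_def)
      then show ?thesis
        by (simp add: Phi_def matrix_mul_lid matrix_mul_rid matrix_mult_minus_left)
    qed
    then show ?thesis
      by (simp add: Phi_gen_tau_Y mat22_one mat22_diff det_mat22 power2_eq_square algebra_simps)
  qed
  ultimately have "twisted_alexander \<alpha> \<beta> (tau \<omega>) = det ?A / (1 - tvar ^ 2)" "det ?A * (1 - tvar ^ 2) = ?d"
    by (simp_all only: twisted_alexander_def det_mul)
  moreover have "A / (1 - u) * (u - 1) ^ 2 = A * (1 - u)" if "u - 1 \<noteq> 0" for A u :: "complex poly fract"
    using that by (simp add: divide_simps) (simp add: power2_eq_square algebra_simps)
  ultimately show ?thesis
    using t by presburger
qed

section \<open>Splitting the determinant\<close>

lemma sum_periodic_shift: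
  fixes g :: "nat \<Rightarrow> 'a::ab_group_add"
  assumes "\<And>j. g (j + n) = g j"
  shows "(\<Sum>i<n. g (m + i)) = (\<Sum>i<n. g i)"
proof (induction m)
  case (Suc m)
  have "(\<Sum>i<n. g (Suc m + i)) = (\<Sum>i<Suc n. g (m + i)) - g m"
    by (simp add: sum.lessThan_Suc_shift del: sum.lessThan_Suc)
  then show ?case using Suc.IH assms[of m] by simp
qed simp

lemma sum_reflect:
  fixes g :: "nat \<Rightarrow> 'a::ab_group_add"
  assumes "g n = g 0"
  shows "(\<Sum>i<n. g (n - i)) = (\<Sum>i<n. g i)"
proof -
  have "(\<Sum>i<n. g (n - i)) = (\<Sum>i<n. g (Suc i))"
    by (rule sum.reindex_bij_witness[of _ "\<lambda>i. n - Suc i" "\<lambda>i. n - Suc i"]) (auto simp: Suc_diff_Suc)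
  also have "\<dots> = (\<Sum>i<Suc n. g i) - g 0"
    by (simp add: sum.lessThan_Suc_shift del: sum.lessThan_Suc)
  finally show ?thesis using assms by simp
qed

text \<open>The prefix sum over one period, with the summation index counted from the centre of symmetry
  \<open>m\<close> and the power of \<open>x\<close> normalized accordingly.\<close>

definition centred_sum :: "(nat \<Rightarrow> bool) \<Rightarrow> (nat \<Rightarrow> bool) \<Rightarrow> nat \<Rightarrow> nat \<Rightarrow> 'a::field \<Rightarrow> 'a \<Rightarrow> 'a" where
  "centred_sum P s a m x t = (\<Sum>i<2 * a. if P (m + i) then x ^ i * t powi height s (m + i) else 0)"

lemma prefix_sum_eq_centred:
  assumes "antiperiodic s a" "x ^ (2 * a) = 1" "\<And>j. P (j + 2 * a) \<longleftrightarrow> P j"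
  shows "prefix_sum P s x t (2 * a) = x ^ m * centred_sum P s a m x t"
proof -
  have "height s (j + 2 * a) = height s j" for j
    by (rule height_period(2)[OF assms(1)])
  then have "prefix_sum P s x t (2 * a) =
      (\<Sum>i<2 * a. if P (m + i) then x ^ (m + i) * t powi height s (m + i) else 0)"
    unfolding prefix_sum_def using assms
    by (intro sum_periodic_shift[symmetric]) (simp add: power_add)
  also have "\<dots> = x ^ m * centred_sum P s a m x t"
    unfolding centred_sum_def sum_distrib_left by (intro sum.cong) (simp_all add: power_add mult.assoc)
  finally show ?thesis .
qed

text \<open>The index reflection \<open>i \<mapsto> 2 a - i\<close> inverts \<open>x ^ i\<close> and preserves the heights. Together with
  the recentring this lets the product of the entries for \<open>x\<close> and \<open>x\<^sup>-\<^sup>1\<close> become a square, and the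
  determinant a difference of two squares.\<close>

lemma centred_sum_inverse:
  fixes x :: "'a::field"
  assumes "antiperiodic s a" "skew_symmetric s a m" "x ^ (2 * a) = 1" "x \<noteq> 0"
    and P: "\<And>j. P (j + 2 * a) \<longleftrightarrow> P j" "\<And>i. i \<le> 2 * a \<Longrightarrow> P (m + (2 * a - i)) \<longleftrightarrow> P (m + i)"
  shows "centred_sum P s a m (inverse x) t = centred_sum P s a m x t"
proof -
  define g where "g = (\<lambda>i. if P (m + i) then x ^ i * t powi height s (m + i) else 0)"
  have sym: "height s (m + (2 * a - i)) = height s (m + i)" if "i \<le> 2 * a" for i
    by (rule height_symmetric[OF assms(1,2) that])
  have x: "inverse x ^ i = x ^ (2 * a - i)" if "i \<le> 2 * a" for i
  proof -
    have "x ^ i * x ^ (2 * a - i) = 1"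
      using assms(3) that by (simp flip: power_add)
    then show ?thesis using assms(4) by (simp add: power_inverse inverse_unique)
  qed
  have "centred_sum P s a m (inverse x) t = (\<Sum>i<2 * a. g (2 * a - i))"
    unfolding centred_sum_def
  proof (rule sum.cong[OF HOL.refl])
    fix i assume "i \<in> {..<2 * a}"
    then have i: "i \<le> 2 * a" by simp
    show "(if P (m + i) then inverse x ^ i * t powi height s (m + i) else 0) = g (2 * a - i)"
      by (simp only: g_def P(2)[OF i] sym[OF i] x[OF i])
  qed
  also have "\<dots> = (\<Sum>i<2 * a. g i)"
    using assms(3) P(1)[of m] sym[of 0] by (intro sum_reflect) (simp add: g_def)
  finally show ?thesis by (simp add: centred_sum_def g_def)
qed

text \<open>The height raised by an even amount that makes it nonnegative; evenness keeps its parity, on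
  which the substitution \<open>t \<mapsto> - t\<close> depends.\<close>

definition exponent :: "(nat \<Rightarrow> bool) \<Rightarrow> nat \<Rightarrow> nat \<Rightarrow> nat \<Rightarrow> nat" where
  "exponent s a m i = nat (height s (m + i) + 2 * int (m + 2 * a))"

lemma int_exponent:
  assumes "i \<le> 2 * a"
  shows "int (exponent s a m i) = height s (m + i) + 2 * int (m + 2 * a)"
  using abs_height_le[of s "m + i"] assms by (simp add: exponent_def)

lemma even_exponent: "i \<le> 2 * a \<Longrightarrow> even (exponent s a m i) \<longleftrightarrow> even (m + i)"
proof -
  assume "i \<le> 2 * a"
  then have "even (int (exponent s a m i)) \<longleftrightarrow> even (height s (m + i))"
    by (subst int_exponent) simp_all
  then show ?thesis by (simp add: even_height)
qed

text \<open>The sum \<open>S\<close> of the argument at the top, multiplied by a power of \<open>t\<close>, with \<open>c\<close> in place of \<open>\<eta>\<close>.\<close>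

definition height_poly :: "(nat \<Rightarrow> bool) \<Rightarrow> nat \<Rightarrow> nat \<Rightarrow> 'a::comm_ring_1 \<Rightarrow> 'a poly" where
  "height_poly s a m c = (\<Sum>i<2 * a. Polynomial.monom ((- c) ^ i) (exponent s a m i))"

text \<open>The quotient of \<open>t\<^sup>d\<close> by \<open>t\<^sup>2 - 1\<close>, with remainder \<open>t\<close> to the power \<open>d mod 2\<close>. Dividing
  monomial by monomial keeps the coefficients in the ring generated by \<open>c\<close>.\<close>

fun quot_monom :: "nat \<Rightarrow> 'a::comm_ring_1 poly" where
  "quot_monom 0 = 0"
| "quot_monom (Suc 0) = 0"
| "quot_monom (Suc (Suc d)) = Polynomial.monom 1 d + quot_monom d"

lemma monom_eq_quot_monom:
  "Polynomial.monom 1 d = [:-1, 0, 1:] * quot_monom d + Polynomial.monom (1 :: 'a::comm_ring_1) (d mod 2)"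
proof (induction d rule: quot_monom.induct)
  case (3 d)
  have "Polynomial.monom 1 (Suc (Suc d)) = [:-1, 0, 1:] * Polynomial.monom 1 d + (Polynomial.monom 1 d :: 'a poly)"
    by (simp add: monom_Suc)
  also have "\<dots> = [:-1, 0, 1:] * Polynomial.monom 1 d + ([:-1, 0, 1:] * quot_monom d + Polynomial.monom (1 :: 'a) (d mod 2))"
    using 3 by simp
  finally show ?case by (simp add: distrib_left del: mult_pCons_left)
qed (simp_all)

text \<open>The quotient \<open>Q\<close> of \<open>S\<close> by \<open>t\<^sup>2 - 1\<close>.\<close>

definition height_quot :: "(nat \<Rightarrow> bool) \<Rightarrow> nat \<Rightarrow> nat \<Rightarrow> 'a::comm_ring_1 \<Rightarrow> 'a poly" where
  "height_quot s a m c = (\<Sum>i<2 * a. Polynomial.smult ((- c) ^ i) (quot_monom (exponent s a m i)))"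

lemma height_poly_division:
  "height_poly s a m c = [:-1, 0, 1:] * height_quot s a m c +
     (\<Sum>i<2 * a. if even (m + i) then [:(- c) ^ i:] else [:0, (- c) ^ i:])"
proof -
  have "Polynomial.monom ((- c) ^ i) (exponent s a m i) =
      [:-1, 0, 1:] * Polynomial.smult ((- c) ^ i) (quot_monom (exponent s a m i)) +
      (if even (m + i) then [:(- c) ^ i:] else [:0, (- c) ^ i:])" if "i < 2 * a" for i
  proof -
    have "Polynomial.monom ((- c) ^ i) (exponent s a m i) = Polynomial.smult ((- c) ^ i) (Polynomial.monom 1 (exponent s a m i))"
      by (simp add: smult_monom)
    also have "\<dots> = [:-1, 0, 1:] * Polynomial.smult ((- c) ^ i) (quot_monom (exponent s a m i)) +
        Polynomial.smult ((- c) ^ i) (Polynomial.monom 1 (exponent s a m i mod 2))"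
      by (subst monom_eq_quot_monom) (simp only: smult_add_right mult_smult_right)
    also have "exponent s a m i mod 2 = (if even (m + i) then 0 else 1)"
      using even_exponent[of i a s m] that by (simp add: mod2_eq_if)
    finally show ?thesis by (simp add: monom_0 monom_Suc)
  qed
  then show ?thesis
    unfolding height_poly_def height_quot_def sum_distrib_left sum.distrib [symmetric]
    by (intro sum.cong) (simp_all only: lessThan_iff)
qed

lemma sum_powers_root_of_unity:
  fixes c :: "'a::field"
  assumes "c ^ N = 1" "c \<noteq> 1"
  shows "(\<Sum>i<N. c ^ i) = 0"
  using assms by (simp add: sum_gp_strict)

text \<open>The remainder collects the powers of \<open>- c\<close> with even and with odd \<open>m + i\<close>. Each
  of the two sums is half the sum or difference of \<open>\<Sum>\<^sub>i (- c)\<^sup>i\<close> and \<open>\<Sum>\<^sub>i c\<^sup>i\<close> over one period,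
  and both of these vanish.\<close>

lemma height_poly_root_of_unity:
  fixes c :: "'a::field_char_0"
  assumes "c ^ (2 * a) = 1" "c ^ 2 \<noteq> 1"
  shows "height_poly s a m c = [:-1, 0, 1:] * height_quot s a m c"
proof -
  have "c \<noteq> 1" "c \<noteq> - 1" using assms(2) by auto
  then have "c \<noteq> 1" "- c \<noteq> 1" by (auto simp: minus_equation_iff [of c])
  then have 0: "(\<Sum>i<2 * a. c ^ i) = 0" "(\<Sum>i<2 * a. (- c) ^ i) = 0"
    using assms(1) by (intro sum_powers_root_of_unity; simp)+
  have *: "2 * (\<Sum>i<2 * a. if even (m + i) = b then (- c) ^ i else 0) = 0" for b
  proof -
    have "2 * (\<Sum>i<2 * a. if even (m + i) = b then (- c) ^ i else 0) =
        (\<Sum>i<2 * a. (- c) ^ i + (if b then 1 else - 1) * (- 1) ^ m * c ^ i)"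
      unfolding sum_distrib_left
      by (intro sum.cong) (auto simp: power_minus' [of c])
    also have "\<dots> = 0"
      by (simp add: sum.distrib 0 flip: sum_distrib_left)
    finally show ?thesis .
  qed
  have "(\<Sum>i<2 * a. if even (m + i) then [:(- c) ^ i:] else [:0, (- c) ^ i:]) =
      (\<Sum>i<2 * a. [:if even (m + i) = True then (- c) ^ i else 0, if even (m + i) = False then (- c) ^ i else 0:])"
    by (intro sum.cong) auto
  also have "\<dots> = [:\<Sum>i<2 * a. if even (m + i) = True then (- c) ^ i else 0,
                  \<Sum>i<2 * a. if even (m + i) = False then (- c) ^ i else 0:]"
    by (simp add: poly_eq_iff coeff_sum coeff_pCons split: nat.splits)
  also have "\<dots> = 0"
    using *[of True] *[of False] by simp
  finally show ?thesis by (simp add: height_poly_division)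
qed

lemma to_fract_const_mult: "to_fract [:c * d:] = to_fract [:c:] * to_fract [:d:]"
proof -
  have "[:c * d:] = [:c:] * [:d:]" by simp
  then show ?thesis by (simp only: to_fract_mult)
qed

lemma to_fract_const_power: "to_fract [:c ^ i:] = to_fract [:c:] ^ i"
  by (induction i) (simp_all add: to_fract_const_one to_fract_const_mult)

lemma to_fract_monom_exponent:
  assumes "i \<le> 2 * a"
  shows "to_fract (Polynomial.monom c (exponent s a m i)) =
    to_fract [:c:] * tvar powi height s (m + i) * tvar ^ (2 * (m + 2 * a))"
proof -
  have "to_fract (Polynomial.monom c d) = to_fract [:c:] * tvar ^ d" for d
  proof (induction d)
    case (Suc d)
    have "Polynomial.monom c (Suc d) = [:0, 1:] * Polynomial.monom c d" by (simp add: monom_Suc)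
    then show ?case by (simp only: to_fract_mult Suc.IH power_Suc tvar_def mult_ac)
  qed (simp add: monom_0)
  moreover have "tvar powi height s (m + i) * tvar ^ (2 * (m + 2 * a)) =
      (tvar powi int (exponent s a m i) :: 'a poly fract)"
  proof -
    have "int (exponent s a m i) = height s (m + i) + int (2 * (m + 2 * a))"
      using int_exponent[OF assms] by simp
    then show ?thesis
      by (simp only: power_int_add power_int_of_nat tvar_nonzero simp_thms)
  qed
  ultimately show ?thesis by (simp add: mult.assoc)
qed

text \<open>Heights have the parity of their index, so \<open>t \<mapsto> - t\<close> changes the sign of the odd part of the
  sum; the signs \<open>(- 1) ^ i\<close> do the same up to the global sign \<open>(- 1) ^ m\<close>.\<close>

lemma to_fract_height_poly:
  fixes c :: "'a::idom"
  defines "x \<equiv> to_fract [:c:]"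
  shows "to_fract (height_poly s a m c) =
      (- 1) ^ m * (centred_sum even s a m x tvar - centred_sum odd s a m x tvar) * tvar ^ (2 * (m + 2 * a))"
    and "to_fract (pcompose (height_poly s a m c) [:0, -1:]) =
      (- 1) ^ m * (centred_sum even s a m x tvar + centred_sum odd s a m x tvar) * tvar ^ (2 * (m + 2 * a))"
proof -
  have x: "to_fract [:(- c) ^ i:] = (- x) ^ i" for i
    using to_fract_const_power[of "- c" i] by (simp add: x_def flip: to_fract_uminus)
  have sgn: "(- x) ^ i = (- 1) ^ m * (if even (m + i) then x ^ i else - (x ^ i))" for i
    by (auto simp: power_minus' [of x])
  have summand: "to_fract (Polynomial.monom ((- c) ^ i) (exponent s a m i)) =
      (- 1) ^ m * (if even (m + i) then x ^ i else - (x ^ i)) * tvar powi height s (m + i) * tvar ^ (2 * (m + 2 * a))"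
    if "i < 2 * a" for i
    using that by (simp add: to_fract_monom_exponent x sgn)
  show "to_fract (height_poly s a m c) =
      (- 1) ^ m * (centred_sum even s a m x tvar - centred_sum odd s a m x tvar) * tvar ^ (2 * (m + 2 * a))"
    unfolding height_poly_def to_fract_sum centred_sum_def sum_subtractf[symmetric] sum_distrib_left sum_distrib_right
    by (intro sum.cong) (simp_all add: summand)
  have comp: "pcompose (Polynomial.monom ((- c) ^ i) (exponent s a m i)) [:0, -1:] =
      (if even (m + i) then Polynomial.monom ((- c) ^ i) (exponent s a m i) else - Polynomial.monom ((- c) ^ i) (exponent s a m i))"
    if "i < 2 * a" for i
  proof -
    have "pcompose (Polynomial.monom b d) [:0, -1:] = Polynomial.monom ((- 1) ^ d * b) d" for b :: 'a and d
      by (induction d) (simp_all add: monom_0 monom_Suc pcompose_pCons minus_monom)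
    then show ?thesis
      using even_exponent[of i a s m] that by (simp add: minus_monom)
  qed
  show "to_fract (pcompose (height_poly s a m c) [:0, -1:]) =
      (- 1) ^ m * (centred_sum even s a m x tvar + centred_sum odd s a m x tvar) * tvar ^ (2 * (m + 2 * a))"
    unfolding height_poly_def pcompose_sum to_fract_sum centred_sum_def sum.distrib[symmetric] sum_distrib_left sum_distrib_right
    by (intro sum.cong) (simp_all add: summand comp)
qed

text \<open>The determinant \<open>C\<^sub>e\<^sup>2 - C\<^sub>o\<^sup>2\<close>, with \<open>C\<^sub>e\<close> and \<open>C\<^sub>o\<close> the even and odd parts of the centred
  sum, is the product of \<open>C\<^sub>e - C\<^sub>o\<close> and \<open>C\<^sub>e + C\<^sub>o\<close>, which \<open>t \<mapsto> - t\<close> exchanges.\<close>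

lemma twisted_alexander_factorization:
  fixes \<eta> :: complex
  assumes R: "knot_R \<alpha> \<beta> = alternating_word s (2 * \<alpha>)"
    and s: "antiperiodic s \<alpha>" "skew_symmetric s \<alpha> m"
    and \<eta>: "\<eta> ^ (2 * \<alpha>) = 1" "\<eta> \<noteq> 0" "\<eta> ^ 4 \<noteq> 1"
  shows "twisted_alexander \<alpha> \<beta> (tau (\<eta> ^ 2 + inverse \<eta> ^ 2 - 2)) * tvar ^ (4 * (m + 2 * \<alpha>)) =
     to_fract (height_quot s \<alpha> m \<eta> * pcompose (height_quot s \<alpha> m \<eta>) [:0, -1:])"
proof -
  define x where "x = to_fract [:\<eta>:]"
  let ?C = "\<lambda>P. centred_sum P s \<alpha> m x tvar" and ?K = "2 * (m + 2 * \<alpha>)"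
  let ?H = "height_poly s \<alpha> m \<eta>" and ?Q = "height_quot s \<alpha> m \<eta>"
  let ?T = "twisted_alexander \<alpha> \<beta> (tau (\<eta> ^ 2 + inverse \<eta> ^ 2 - 2))"
  have x0: "x \<noteq> 0" using \<eta> by (simp add: x_def)
  have pow: "x ^ i = 1 \<longleftrightarrow> \<eta> ^ i = 1" for i
  proof -
    have "x ^ i = to_fract [:\<eta> ^ i:]" by (simp add: x_def to_fract_const_power)
    moreover have "to_fract [:\<eta> ^ i:] = 1 \<longleftrightarrow> \<eta> ^ i = 1"
      using to_fract_eq_iff[of "[:\<eta> ^ i:]" "[:1:]"] unfolding to_fract_const_one by simp
    ultimately show ?thesis by simp
  qed
  have inv: "inverse x = to_fract [:inverse \<eta>:]"
    using \<eta>(2) by (intro inverse_unique) (simp add: x_def to_fract_const_one flip: to_fract_const_mult)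
  have w: "to_fract [:\<eta> ^ 2 + inverse \<eta> ^ 2 - 2:] = x ^ 2 + inverse x ^ 2 - 2"
  proof -
    have "[:\<eta> ^ 2 + inverse \<eta> ^ 2 - 2:] = [:\<eta> ^ 2:] + [:inverse \<eta> ^ 2:] - ([:1:] + [:1:])"
      by simp
    then show ?thesis
      by (simp only: to_fract_add to_fract_diff to_fract_const_power to_fract_const_one inv) (simp add: x_def)
  qed
  have prod: "prefix_sum P s x tvar (2 * \<alpha>) * prefix_sum P s (inverse x) tvar (2 * \<alpha>) = ?C P ^ 2"
    if P: "\<And>j. P (j + 2 * \<alpha>) \<longleftrightarrow> P j" "\<And>i. i \<le> 2 * \<alpha> \<Longrightarrow> P (m + (2 * \<alpha> - i)) \<longleftrightarrow> P (m + i)" for P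
  proof -
    have "x ^ (2 * \<alpha>) = 1" using \<eta>(1) by (simp only: pow)
    then have "inverse x ^ (2 * \<alpha>) = 1" by (simp add: power_inverse)
    have "prefix_sum P s x tvar (2 * \<alpha>) = x ^ m * ?C P"
      by (rule prefix_sum_eq_centred) (use s P \<open>x ^ (2 * \<alpha>) = 1\<close> in auto)
    moreover have "prefix_sum P s (inverse x) tvar (2 * \<alpha>) = inverse x ^ m * ?C P"
      using prefix_sum_eq_centred[of s \<alpha> "inverse x" P tvar m] centred_sum_inverse[of s \<alpha> m x P tvar]
        s P \<open>x ^ (2 * \<alpha>) = 1\<close> \<open>inverse x ^ (2 * \<alpha>) = 1\<close> x0 by auto
    ultimately show ?thesis
      using x0 by (simp add: power2_eq_square field_simps)
  qed
  have "?T * (tvar ^ 2 - 1) ^ 2 = ?C even ^ 2 - ?C odd ^ 2"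
  proof -
    have "?T * (tvar ^ 2 - 1) ^ 2 =
        prefix_sum even s x tvar (2 * \<alpha>) * prefix_sum even s (inverse x) tvar (2 * \<alpha>) -
        prefix_sum odd s x tvar (2 * \<alpha>) * prefix_sum odd s (inverse x) tvar (2 * \<alpha>)"
      by (rule twisted_alexander_alternating) (use x0 w R pow \<eta>(3) in simp_all)
    also have "\<dots> = ?C even ^ 2 - ?C odd ^ 2"
      by (subst (1 2) prod) (auto simp: even_diff_nat)
    finally show ?thesis .
  qed
  moreover have "to_fract (?H * pcompose ?H [:0, -1:]) = (?C even ^ 2 - ?C odd ^ 2) * tvar ^ (2 * ?K)"
  proof -
    have "(- 1) ^ m * (- 1) ^ m = (1 :: complex poly fract)"
      by (simp flip: power_mult_distrib)
    then have sq: "(- 1) ^ m * (p - q) * t * ((- 1) ^ m * (p + q) * t) = (p ^ 2 - q ^ 2) * (t * t)"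
      for p q t :: "complex poly fract"
      by (simp add: power2_eq_square algebra_simps)
    show ?thesis
      unfolding to_fract_mult to_fract_height_poly x_def [symmetric] sq power_add [symmetric] mult_2 by (rule HOL.refl)
  qed
  ultimately have 1: "?T * tvar ^ (2 * ?K) * (tvar ^ 2 - 1) ^ 2 = to_fract (?H * pcompose ?H [:0, -1:])"
    by (simp add: mult_ac)
  have "\<eta> ^ 2 \<noteq> 1" using \<eta>(3) by (metis numeral_Bit0 power_add power_one)
  then have H: "?H = [:-1, 0, 1:] * ?Q"
    by (intro height_poly_root_of_unity \<eta>(1))
  have "pcompose ?H [:0, -1:] = [:-1, 0, 1:] * pcompose ?Q [:0, -1:]"
    unfolding H pcompose_mult by (simp add: pcompose_pCons)
  moreover have t: "tvar ^ 2 - 1 = to_fract [:-1, 0, 1 :: complex:]"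
  proof -
    have "[:-1, 0, 1 :: complex:] = [:0, 1:] * [:0, 1:] - 1" by (simp add: one_pCons)
    then show ?thesis by (simp only: to_fract_mult to_fract_diff to_fract_1 tvar_def power2_eq_square)
  qed
  ultimately have "to_fract (?H * pcompose ?H [:0, -1:]) =
      to_fract (?Q * pcompose ?Q [:0, -1:]) * (tvar ^ 2 - 1) ^ 2"
    by (subst H) (simp only: to_fract_mult power2_eq_square mult_ac)
  with 1 have "?T * tvar ^ (2 * ?K) * (tvar ^ 2 - 1) ^ 2 =
      to_fract (?Q * pcompose ?Q [:0, -1:]) * (tvar ^ 2 - 1) ^ 2"
    by simp
  moreover have "tvar ^ 2 - 1 \<noteq> (0 :: complex poly fract)"
    unfolding t by (simp only: to_fract_eq_0_iff pCons_eq_0_iff) simp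
  ultimately show ?thesis by simp
qed

section \<open>The Alexander polynomial\<close>

lemma exp_sum_snoc: "exp_sum (w @ [(h, b)]) = exp_sum w + (if b then 1 else -1)"
  by (simp add: exp_sum_def)

lemma exp_sum_alternating: "exp_sum (alternating_word s N) = height s N"
  by (induction N) (simp_all add: alternating_word_Suc exp_sum_snoc, simp add: exp_sum_def)

definition fox_abelianized :: "gen \<Rightarrow> gen word \<Rightarrow> int poly fract" where
  "fox_abelianized g w = (\<Sum>(c, u)\<leftarrow>fox g w. of_int c * tvar powi exp_sum u)"

lemma fox_abelianized_snoc:
  "fox_abelianized g (w @ [(h, b)]) * (tvar - 1) = fox_abelianized g w * (tvar - 1) +
     (if h = g then tvar powi exp_sum (w @ [(h, b)]) - tvar powi exp_sum w else 0)"
  by (simp add: fox_abelianized_def fox_snoc exp_sum_snoc power_int_add power_int_diff power_int_minus field_simps)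

lemma fox_abelianized_alternating_step:
  "fox_abelianized g (alternating_word s (Suc N)) * (tvar - 1) = fox_abelianized g (alternating_word s N) * (tvar - 1) +
     (if (if odd (Suc N) then X else Y) = g then tvar powi height s (Suc N) - tvar powi height s N else 0)"
  unfolding alternating_word_Suc fox_abelianized_snoc
  by (simp add: exp_sum_alternating exp_sum_snoc)

lemma fox_abelianized_X_alternating:
  "fox_abelianized X (alternating_word s (2 * k)) * (tvar - 1) =
     - prefix_sum (\<lambda>_. True) s (- 1) tvar (2 * k)"
proof (induction k)
  case 0
  then show ?case by (simp add: fox_abelianized_def prefix_sum_def)
next
  case (Suc k)
  then show ?case
    using fox_abelianized_alternating_step[of X s "2 * k"] fox_abelianized_alternating_step[of X s "Suc (2 * k)"]
    by (simp add: prefix_sum_def)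
qed

text \<open>The fundamental formula of Fox calculus under abelianization. For the relator it shows that
  the two entries of the Alexander matrix are negatives of each other.\<close>

lemma fox_abelianized_X_plus_Y:
  "(fox_abelianized X (alternating_word s N) + fox_abelianized Y (alternating_word s N)) * (tvar - 1) =
     tvar powi height s N - 1"
proof (induction N)
  case 0
  then show ?case by (simp add: fox_abelianized_def)
next
  case (Suc N)
  then show ?case
    unfolding distrib_right fox_abelianized_alternating_step by auto
qed

lemma tvar_minus_one_nonzero: "tvar - 1 \<noteq> (0 :: 'a::idom poly fract)"
proof -
  have "tvar - 1 = (to_fract [:- 1, 1:] :: 'a poly fract)"
  proof -
    have "[:- 1, 1 :: 'a:] = [:0, 1:] - 1" by (simp add: one_pCons)
    then show ?thesis by (simp only: to_fract_diff to_fract_1 tvar_def)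
  qed
  then show ?thesis by (simp only: to_fract_eq_0_iff pCons_eq_0_iff) simp
qed

lemma sum_signs_by_parity:
  "(\<Sum>i<2 * a. if even (m + i) then [:(- 1) ^ i:] else [:0, (- 1) ^ i:]) =
     (- 1) ^ m * [:int a, - int a:]"
proof (induction a)
  case (Suc a)
  have "(- 1) ^ m * [:int (Suc a), - int (Suc a):] =
      (- 1) ^ m * [:int a, - int a:] + (- 1) ^ m * [:1, - 1:]"
    unfolding distrib_left [symmetric] by (rule arg_cong[of _ _ "(*) ((- 1) ^ m)"]) simp
  with Suc show ?case by (cases "even m") (simp_all)
qed simp

text \<open>Arithmetic form of the Alexander polynomial that displays its reduction modulo a divisor of
  \<open>a\<close> as a multiple of \<open>1 + t\<close>.\<close>

definition alexander_poly :: "(nat \<Rightarrow> bool) \<Rightarrow> nat \<Rightarrow> nat \<Rightarrow> int poly" where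
  "alexander_poly s a m = [:int a:] - (- 1) ^ m * ([:1, 1:] * height_quot s a m 1)"

text \<open>Times \<open>t - 1\<close>, the entry is the alternating sum of the powers \<open>t\<^sup>e\<close>, that is,
  \<open>height_poly\<close> at \<open>c = 1\<close>. Its remainder on division by \<open>t\<^sup>2 - 1\<close> is \<open>a (1 - t)\<close> up to sign, so
  \<open>t - 1\<close> cancels.\<close>

lemma fox_abelianized_alexander_poly:
  assumes "antiperiodic s a"
  shows "fox_abelianized X (alternating_word s (2 * a)) * tvar ^ (2 * (m + 2 * a)) = to_fract (alexander_poly s a m)"
proof -
  let ?K = "2 * (m + 2 * a)" and ?C = "centred_sum (\<lambda>_. True) s a m (- 1) tvar :: int poly fract"
  have 1: "to_fract (height_poly s a m 1) = ?C * tvar ^ ?K"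
  proof -
    have sgn: "to_fract [:(- 1) ^ i:] = (- 1 :: int poly fract) ^ i" for i :: nat
      by (simp only: to_fract_const_power to_fract_const_one)
    have "to_fract (Polynomial.monom ((- 1) ^ i) (exponent s a m i)) =
        (- 1 :: int poly fract) ^ i * tvar powi height s (m + i) * tvar ^ ?K" if "i < 2 * a" for i
      using that by (simp only: to_fract_monom_exponent less_imp_le sgn)
    then show ?thesis
      unfolding height_poly_def to_fract_sum centred_sum_def sum_distrib_right
      by (intro sum.cong) simp_all
  qed
  have 2: "fox_abelianized X (alternating_word s (2 * a)) * (tvar - 1) = - ((- 1) ^ m * ?C)"
    unfolding fox_abelianized_X_alternating
    using prefix_sum_eq_centred[of s a "- 1" "\<lambda>_. True" tvar m] assms by simp
  have "fox_abelianized X (alternating_word s (2 * a)) * tvar ^ ?K * (tvar - 1) =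
      fox_abelianized X (alternating_word s (2 * a)) * (tvar - 1) * tvar ^ ?K"
    by (simp only: mult_ac)
  also have "\<dots> = - ((- 1) ^ m * to_fract (height_poly s a m 1))"
    unfolding 1 2 by (simp only: mult_minus_left mult.assoc)
  also have "\<dots> = to_fract (- ((- 1) ^ m * height_poly s a m 1))"
  proof -
    have "to_fract ((- 1) ^ m) = (- 1 :: int poly fract) ^ m"
      by (induction m) simp_all
    then show ?thesis by simp
  qed
  also have "- ((- 1) ^ m * height_poly s a m 1) = alexander_poly s a m * [:- 1, 1:]"
  proof -
    have "(- 1) ^ m * ((- 1) ^ m * f) = f" for f :: "int poly"
      by (simp flip: mult.assoc power_mult_distrib)
    moreover have "[:- 1, 0, 1:] = [:1, 1:] * [:- 1, 1 :: int:]"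
      "[:int a, - int a:] = - ([:int a:] * [:- 1, 1:])"
      by simp_all
    ultimately show ?thesis
      unfolding height_poly_division sum_signs_by_parity alexander_poly_def
      by (simp only: distrib_left left_diff_distrib mult_minus_right minus_add_distrib minus_minus) (simp only: mult_ac diff_conv_add_uminus add_ac)
  qed
  also have "to_fract (alexander_poly s a m * [:- 1, 1:]) = to_fract (alexander_poly s a m) * (tvar - 1)"
  proof -
    have "[:- 1, 1 :: int:] = [:0, 1:] - 1" by (simp add: one_pCons)
    then show ?thesis by (simp only: to_fract_mult to_fract_diff to_fract_1 tvar_def)
  qed
  finally show ?thesis
    using tvar_minus_one_nonzero[where 'a = int] by simp
qed

lemma poly_alexander_poly_minus_one: "poly (alexander_poly s a m) (- 1) = int a"
  by (simp add: alexander_poly_def)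

lemma to_fract_tvar_power: "to_fract ([:0, 1:] ^ j) = (tvar :: 'a::idom poly fract) ^ j"
  by (induction j) (simp_all only: power_0 power_Suc to_fract_1 to_fract_mult tvar_def)

lemma laurent_polys_clear_denominator:
  assumes "x \<in> laurent_polys"
  obtains N f where "x * tvar ^ N = to_fract f"
proof -
  obtain f k where x: "x = to_fract f * tvar powi k"
    using assms by (auto simp: laurent_polys_def)
  have "x * tvar ^ nat (- k) = to_fract (f * [:0, 1:] ^ nat k)"
  proof (cases "k \<ge> 0")
    case True
    then have "tvar powi k = (tvar :: 'a poly fract) ^ nat k" by (simp add: power_int_nonneg_exp)
    then show ?thesis using True by (simp only: x to_fract_mult to_fract_tvar_power) simp
  next
    case False
    then have "tvar powi k * tvar ^ nat (- k) = (1 :: 'a poly fract)"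
      by (simp add: power_int_def flip: power_mult_distrib)
    with False show ?thesis by (simp add: x mult.assoc)
  qed
  then show ?thesis by (rule that)
qed

lemma dvd_variable_power:
  fixes h c :: "int poly"
  assumes "h * c = [:0, 1:] ^ L"
  shows "\<exists>u\<in>{1, -1}. \<exists>l. h = u * [:0, 1:] ^ l"
  using assms
proof (induction L arbitrary: h c)
  case 0
  then have "h dvd 1" by (metis dvd_triv_left power_0)
  then obtain k where k: "h = [:k:]" "k dvd 1"
    by (auto simp: is_unit_poly_iff)
  then have "h = 1 \<or> h = - 1" by (auto simp: one_pCons)
  then show ?case by (intro bexI[of _ h] exI[of _ 0]) auto
next
  case (Suc L)
  have "coeff h 0 * coeff c 0 = 0"
    using arg_cong[OF Suc.prems, of "\<lambda>f. coeff f 0"] by (simp add: coeff_mult)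
  then consider "coeff h 0 = 0" | "coeff c 0 = 0" by auto
  then show ?case
  proof cases
    case 1
    then obtain h' where h: "h = [:0, 1:] * h'" by (cases h) auto
    then have "h' * c = [:0, 1:] ^ L" using Suc.prems by (simp add: mult.assoc)
    from Suc.IH[OF this] obtain u l where "u \<in> {1, -1}" "h' = u * [:0, 1:] ^ l" by blast
    then show ?thesis unfolding h by (intro bexI[of _ u] exI[of _ "Suc l"]) (auto simp: mult_ac)
  next
    case 2
    then obtain c' where "c = [:0, 1:] * c'" by (cases c) auto
    then have "h * c' = [:0, 1:] ^ L" using Suc.prems by (simp add: mult.left_commute)
    from Suc.IH[OF this] show ?thesis .
  qed
qed

text \<open>The elementary ideal is generated by one entry, so \<open>\<Delta>\<close> and that entry divide each other
  in the Laurent polynomials, whose units are \<open>\<plusminus>t\<^sup>k\<close>. The second claim is the divisibility with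
  denominators cleared, ready for evaluation at \<open>- 1\<close>.\<close>

lemma alexander_polynomial_eq_units:
  assumes s: "antiperiodic s a" and a: "a \<noteq> 0" and R: "knot_R a b = alternating_word s (2 * a)"
    and \<Delta>: "alexander_polynomial a b \<Delta>"
  shows "eq_units \<Delta> (alexander_poly s a m)"
    and "\<exists>c k. [:0, 1:] ^ k * alexander_poly s a m = c * \<Delta>"
proof -
  let ?A = "alexander_poly s a m" and ?K = "2 * (m + 2 * a)"
  let ?x = "alexander_entry a b X" and ?y = "alexander_entry a b Y"
  have entry: "alexander_entry a b g = fox_abelianized g (alternating_word s (2 * a))" for g
    by (simp add: alexander_entry_def fox_abelianized_def R)
  have x: "?x * tvar ^ ?K = to_fract ?A"
    unfolding entry by (rule fox_abelianized_alexander_poly[OF s])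
  have "(?x + ?y) * (tvar - 1) = 0"
    unfolding entry fox_abelianized_X_plus_Y
    using height_period(1)[OF s] by simp
  then have y: "?y = - ?x"
    using tvar_minus_one_nonzero[where 'a = int] by (simp add: add_eq_0_iff)
  have ideal: "{u * ?x + v * ?y | u v. u \<in> laurent_polys \<and> v \<in> laurent_polys} = {c * to_fract \<Delta> | c. c \<in> laurent_polys}"
    using \<Delta> by (simp add: alexander_polynomial_def)
  have one: "1 \<in> laurent_polys" and zero: "0 \<in> laurent_polys"
    unfolding laurent_polys_def mem_Collect_eq
    by (rule exI[of _ 1], rule exI[of _ 0], simp) (rule exI[of _ 0], rule exI[of _ 0], simp)
  have "1 * to_fract \<Delta> \<in> {u * ?x + v * ?y | u v. u \<in> laurent_polys \<and> v \<in> laurent_polys}"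
    unfolding ideal using one by blast
  then obtain u v where uv: "u \<in> laurent_polys" "v \<in> laurent_polys" "to_fract \<Delta> = (u - v) * ?x"
    unfolding y by (auto simp: algebra_simps)
  obtain N f where f: "u * tvar ^ N = to_fract f"
    using uv(1) by (rule laurent_polys_clear_denominator)
  obtain M g where g: "v * tvar ^ M = to_fract g"
    using uv(2) by (rule laurent_polys_clear_denominator)
  \<comment> \<open>The cofactor of \<open>\<Delta>\<close> with the denominators of \<open>u\<close> and \<open>v\<close> cleared.\<close>
  define h where "h = f * [:0, 1:] ^ M - g * [:0, 1:] ^ N"
  have "to_fract ([:0, 1:] ^ (N + M + ?K) * \<Delta>) =
      (u * tvar ^ N * tvar ^ M - v * tvar ^ M * tvar ^ N) * (?x * tvar ^ ?K)"
    by (simp add: to_fract_tvar_power uv(3) power_add algebra_simps)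
  also have "\<dots> = to_fract (h * ?A)"
    unfolding f g x by (simp add: h_def to_fract_tvar_power)
  finally have 1: "[:0, 1:] ^ (N + M + ?K) * \<Delta> = h * ?A"
    by (simp only: to_fract_eq_iff)
  have "1 * ?x + 0 * ?y \<in> {c * to_fract \<Delta> | c. c \<in> laurent_polys}"
    unfolding ideal[symmetric] using one zero by blast
  then obtain c where c: "c \<in> laurent_polys" "?x = c * to_fract \<Delta>" by auto
  obtain L e where e: "c * tvar ^ L = to_fract e"
    using c(1) by (rule laurent_polys_clear_denominator)
  have "to_fract ([:0, 1:] ^ L * ?A) = (c * tvar ^ L) * tvar ^ ?K * to_fract \<Delta>"
    unfolding to_fract_mult x [symmetric] c(2) to_fract_tvar_power by (simp only: mult_ac)
  also have "\<dots> = to_fract (e * [:0, 1:] ^ ?K * \<Delta>)"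
    unfolding e to_fract_mult to_fract_tvar_power ..
  finally have 2: "[:0, 1:] ^ L * ?A = e * [:0, 1:] ^ ?K * \<Delta>"
    by (simp only: to_fract_eq_iff)
  then show "\<exists>c k. [:0, 1:] ^ k * ?A = c * \<Delta>" by blast
  have "?A \<noteq> 0"
    using poly_alexander_poly_minus_one[of s a m] a by auto
  have "(h * (e * [:0, 1:] ^ ?K)) * ?A = [:0, 1:] ^ (N + M + ?K + L) * ?A"
  proof -
    have "(h * (e * [:0, 1:] ^ ?K)) * ?A = e * [:0, 1:] ^ ?K * (h * ?A)"
      by (simp only: mult_ac)
    also have "\<dots> = [:0, 1:] ^ (N + M + ?K) * (e * [:0, 1:] ^ ?K * \<Delta>)"
      unfolding 1 [symmetric] by (simp only: mult_ac)
    also have "\<dots> = [:0, 1:] ^ (N + M + ?K + L) * ?A"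
      unfolding 2 [symmetric] power_add [of _ _ L] by (simp only: mult_ac)
    finally show ?thesis .
  qed
  then have "h * (e * [:0, 1:] ^ ?K) = [:0, 1:] ^ (N + M + ?K + L)"
    using mult_right_cancel[OF \<open>?A \<noteq> 0\<close>] by blast
  from dvd_variable_power[OF this] obtain w l where w: "w \<in> {1, -1}" "h = w * [:0, 1:] ^ l"
    by blast
  show "eq_units \<Delta> ?A"
    unfolding eq_units_def using w 1 by blast
qed

section \<open>Products over the roots of a monic polynomial\<close>

lemma (in comm_ring_hom) poly_map_poly_mult_add:
  "poly (map_poly hom (f * g + r)) x = poly (map_poly hom f) x * poly (map_poly hom g) x + poly (map_poly hom r) x"
proof -
  have "map_poly hom (f * g + r) = map_poly hom f * map_poly hom g + map_poly hom r"
    by (rule poly_eqI) (simp add: coeff_map_poly coeff_mult hom_add hom_sum hom_mult)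
  then show ?thesis by simp
qed

lemma (in comm_ring_hom) poly_map_poly_mult_diff:
  "poly (map_poly hom (f * g - r)) x = poly (map_poly hom f) x * poly (map_poly hom g) x - poly (map_poly hom r) x"
proof -
  have "map_poly hom (f * g - r) = map_poly hom f * map_poly hom g - map_poly hom r"
    by (rule poly_eqI) (simp add: coeff_map_poly coeff_mult hom_minus hom_sum hom_mult)
  then show ?thesis by simp
qed

lemma monic_division:
  fixes g :: "'a::idom poly"
  assumes "lead_coeff g = 1"
  obtains q r where "f = g * q + r" "r = 0 \<or> degree r < degree g"
proof -
  obtain q r where qr: "pseudo_divmod f g = (q, r)" by fastforce
  have "g \<noteq> 0" using assms by auto
  from pseudo_divmod[OF this qr]
  have "Polynomial.smult (lead_coeff g ^ (Suc (degree f) - degree g)) f = g * q + r" "r = 0 \<or> degree r < degree g"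
    by this+
  then show ?thesis using assms that by simp
qed

lemma dvd_prod_diff:
  fixes f g :: "'i \<Rightarrow> 'a::comm_ring_1"
  assumes "\<And>i. i \<in> A \<Longrightarrow> d dvd f i - g i"
  shows "d dvd prod f A - prod g A"
  using assms
proof (induction A rule: infinite_finite_induct)
  case (insert i A)
  have "f i * prod f A - g i * prod g A = (f i - g i) * prod f A + g i * (prod f A - prod g A)"
    by (simp add: algebra_simps)
  then show ?case using insert by simp
qed simp_all

text \<open>A vector in the left kernel is the coefficient vector of a polynomial of degree less than
  \<open>n\<close> with \<open>n\<close> roots.\<close>

lemma det_vandermonde_nonzero:
  fixes w :: "nat \<Rightarrow> 'a::idom"
  assumes inj: "inj_on w {..<n}"
  shows "Determinant.det (Matrix.mat n n (\<lambda>(j, k). w k ^ j)) \<noteq> 0"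
proof
  let ?V = "Matrix.mat n n (\<lambda>(j, k). w k ^ j)"
  assume "Determinant.det ?V = 0"
  then have "Determinant.det (transpose_mat ?V) = 0"
    by (subst Determinant.det_transpose) auto
  then obtain v where v: "v \<in> carrier_vec n" "v \<noteq> 0\<^sub>v n" "transpose_mat ?V *\<^sub>v v = 0\<^sub>v n"
    using det_0_iff_vec_prod_zero[of "transpose_mat ?V" n] by auto
  define f where "f = (\<Sum>j<n. Polynomial.monom (vec_index v j) j)"
  have root: "poly f (w k) = 0" if k: "k < n" for k
  proof -
    have "vec_index (transpose_mat ?V *\<^sub>v v) k = (\<Sum>j<n. w k ^ j * vec_index v j)"
      using k v(1) by (simp add: scalar_prod_def atLeast0LessThan)
    then show ?thesis
      using v(3) k by (simp add: f_def poly_sum poly_monom mult.commute)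
  qed
  have coeff: "coeff f j = (if j < n then vec_index v j else 0)" for j
    by (simp add: f_def coeff_sum sum.delta)
  have "f = 0"
  proof (rule ccontr)
    assume "f \<noteq> 0"
    have "n > 0" using \<open>f \<noteq> 0\<close> by (cases n) (auto simp: f_def)
    then have "degree f < n"
      using coeff by (metis \<open>f \<noteq> 0\<close> leading_coeff_0_iff)
    have "n = card (w ` {..<n})" using inj by (simp add: card_image)
    also have "\<dots> \<le> card {x. poly f x = 0}"
      using root \<open>f \<noteq> 0\<close> by (intro card_mono poly_roots_finite) auto
    also have "\<dots> \<le> degree f"
      using \<open>f \<noteq> 0\<close> by (rule card_poly_roots_bound)
    finally show False using \<open>degree f < n\<close> by simp
  qed
  then have "vec_index v j = 0" if "j < n" for j
    using coeff[of j] that by simp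
  then have "v = 0\<^sub>v n" using v(1) by (intro eq_vecI) auto
  with v(2) show False by simp
qed

text \<open>The product is the norm of \<open>h\<close> modulo \<open>g\<close>. Let \<open>A\<close> be the matrix of multiplication by
  \<open>h\<close> on the powers \<open>z\<^sup>i\<close> modulo \<open>g\<close>; its entries lie in the base ring because \<open>g\<close> is monic. The
  Vandermonde matrix of the roots diagonalizes it with eigenvalues \<open>h(w)\<close>, so \<open>N = det A\<close>.
  Modulo \<open>d\<close> the polynomial \<open>g\<close> is a power of \<open>z\<close>, multiplication by \<open>h\<close> is triangular, and its
  diagonal entries are the constant coefficient of \<open>h\<close>.\<close>

lemma prod_over_roots_in_image:
  fixes hom :: "'a::idom \<Rightarrow> 'b::idom" and g h :: "'a poly" and W :: "'b set"
  assumes hom: "comm_ring_hom hom"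
    and g: "lead_coeff g = 1" and W: "finite W" "card W = degree g"
    and roots: "\<And>w. w \<in> W \<Longrightarrow> poly (map_poly hom g) w = 0"
    and d: "\<And>k. k < degree g \<Longrightarrow> d dvd coeff g k"
  obtains N where "hom N = (\<Prod>w\<in>W. poly (map_poly hom h) w)" "d dvd N - coeff h 0 ^ degree g"
proof -
  interpret comm_ring_hom hom by (rule hom)
  define n where "n = degree g"
  obtain w where w: "bij_betw w {..<n} W"
    using ex_bij_betw_nat_finite[OF W(1)] W(2) by (auto simp: n_def atLeast0LessThan)
  have "\<exists>q r. Polynomial.monom 1 i * h = g * q + r \<and> (r = 0 \<or> degree r < n)" for i
    using monic_division[OF g, of "Polynomial.monom 1 i * h"] unfolding n_def by metis
  then obtain q r where qr: "\<And>i. Polynomial.monom 1 i * h = g * q i + r i"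
      "\<And>i. r i = 0 \<or> degree (r i) < n"
    by metis
  define A where "A = Matrix.mat n n (\<lambda>(i, j). coeff (r i) j)"
  define H where "H = (\<lambda>k. poly (map_poly hom h) (w k))"
  let ?V = "Matrix.mat n n (\<lambda>(j, k). w k ^ j)"
  let ?D = "Matrix.mat n n (\<lambda>(j, k). if j = k then H k else 0)"
  have AV: "map_mat hom A * ?V = ?V * ?D"
  proof (rule eq_matI)
    fix i k assume "i < dim_row (?V * ?D)" "k < dim_col (?V * ?D)"
    then have i: "i < n" and k: "k < n" by simp_all
    have eval: "poly (map_poly hom (r i)) (w k) = (\<Sum>j<n. hom (coeff (r i) j) * w k ^ j)"
    proof -
      have "coeff (map_poly hom (r i)) j = 0" if "j \<ge> n" for j
        using qr(2)[of i] that by (auto simp: coeff_map_poly coeff_eq_0)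
      then have "poly (map_poly hom (r i)) (w k) = (\<Sum>j<n. coeff (map_poly hom (r i)) j * w k ^ j)"
        unfolding poly_altdef
        by (intro sum.mono_neutral_cong) (auto simp: coeff_eq_0 not_less not_le)
      then show ?thesis by (simp add: coeff_map_poly)
    qed
    have "w k \<in> W" using w k by (auto simp: bij_betw_def)
    then have "poly (map_poly hom (r i)) (w k) = poly (map_poly hom (Polynomial.monom 1 i * h)) (w k)"
      using roots by (simp add: qr(1)[of i] poly_map_poly_mult_add)
    also have "\<dots> = w k ^ i * H k"
      using poly_map_poly_mult_add[of "Polynomial.monom 1 i" h 0 "w k"]
      by (simp add: map_poly_monom poly_monom H_def)
    finally have "(\<Sum>j<n. hom (coeff (r i) j) * w k ^ j) = w k ^ i * H k"
      using eval by simp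
    moreover have "(\<Sum>j<n. w j ^ i * (if j = k then H k else 0)) = w k ^ i * H k"
      using k by (simp add: sum.delta' if_distrib cong: if_cong)
    ultimately show "(map_mat hom A * ?V) $$ (i, k) = (?V * ?D) $$ (i, k)"
      using i k by (simp add: A_def scalar_prod_def atLeast0LessThan)
  qed (simp_all add: A_def)
  have "hom (Determinant.det A) * Determinant.det ?V = Determinant.det ?V * Determinant.det ?D"
    using arg_cong[OF AV, of Determinant.det]
    by (simp add: det_mult[of _ n] A_def flip: hom_det)
  moreover have "Determinant.det ?V \<noteq> 0"
    using w by (intro det_vandermonde_nonzero) (simp add: bij_betw_def)
  moreover have "Determinant.det ?D = (\<Prod>w\<in>W. poly (map_poly hom h) w)"
  proof -
    have "Determinant.det ?D = prod_list (diag_mat ?D)"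
      by (rule det_upper_triangular[of _ n]) (auto simp: upper_triangular_def)
    also have "\<dots> = (\<Prod>k<n. H k)"
      by (simp add: prod_list_diag_prod atLeast0LessThan)
    also have "\<dots> = (\<Prod>w\<in>W. poly (map_poly hom h) w)"
      unfolding H_def by (rule prod.reindex_bij_betw[OF w])
    finally show ?thesis .
  qed
  ultimately have 1: "hom (Determinant.det A) = (\<Prod>w\<in>W. poly (map_poly hom h) w)"
    by simp
  define U where "U = Matrix.mat n n (\<lambda>(i, j). if j < i then 0 else coeff h (j - i))"
  \<comment> \<open>\<open>U\<close> is the matrix of multiplication by \<open>h\<close> modulo \<open>z\<^sup>n\<close>.\<close>
  have AU: "d dvd A $$ (i, j) - U $$ (i, j)" if "i < n" "j < n" for i j
  proof -
    have "coeff (Polynomial.monom 1 i * h) j = (\<Sum>k\<le>j. coeff g k * coeff (q i) (j - k)) + coeff (r i) j"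
      unfolding qr(1)[of i] by (simp add: coeff_mult)
    moreover have "coeff (Polynomial.monom 1 i * h) j = U $$ (i, j)" "coeff (r i) j = A $$ (i, j)"
      using that by (auto simp: A_def U_def coeff_monom_mult)
    ultimately have "A $$ (i, j) - U $$ (i, j) = - (\<Sum>k\<le>j. coeff g k * coeff (q i) (j - k))"
      by simp
    moreover have "d dvd (\<Sum>k\<le>j. coeff g k * coeff (q i) (j - k))"
      using d that by (intro dvd_sum dvd_mult2) (auto simp: n_def)
    ultimately show ?thesis by simp
  qed
  have "d dvd Determinant.det A - Determinant.det U"
  proof -
    have "Determinant.det A - Determinant.det U = (\<Sum>p\<in>{p. p permutes {0..<n}}.
        signof p * ((\<Prod>i=0..<n. A $$ (i, p i)) - (\<Prod>i=0..<n. U $$ (i, p i))))"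
      by (simp add: det_def'[of _ n] A_def U_def sum_subtractf right_diff_distrib)
    moreover have "d dvd (\<Prod>i=0..<n. A $$ (i, p i)) - (\<Prod>i=0..<n. U $$ (i, p i))"
      if "p permutes {0..<n}" for p
      using AU permutes_in_image[OF that] by (intro dvd_prod_diff) auto
    ultimately show ?thesis by (auto intro!: dvd_sum)
  qed
  moreover have "Determinant.det U = coeff h 0 ^ n"
  proof -
    have "Determinant.det U = prod_list (diag_mat U)"
      by (rule det_upper_triangular[of _ n]) (auto simp: upper_triangular_def U_def)
    then show ?thesis by (simp add: prod_list_diag_prod U_def)
  qed
  ultimately show ?thesis using that 1 by (simp add: n_def)
qed

section \<open>The polynomials with the dihedral parameters as roots\<close>

text \<open>The recursion is the one satisfied by \<open>\<Sum>\<^sub>j s\<^sup>j\<close>, \<open>- n \<le> j \<le> n\<close>, as a polynomial in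
  \<open>z = s + s\<^sup>-\<^sup>1 - 2\<close>; integrality and the roots are immediate from it.\<close>

fun theta_int :: "nat \<Rightarrow> int poly" where
  "theta_int 0 = 1"
| "theta_int (Suc 0) = [:3, 1:]"
| "theta_int (Suc (Suc n)) = [:2, 1:] * theta_int (Suc n) - theta_int n"

lemma coeff_theta_int:
  "coeff (theta_int n) k = int ((n + k + 1) choose (2 * k + 1)) + int ((n + k) choose (2 * k + 1))"
proof (induction n arbitrary: k rule: theta_int.induct)
  case 1
  show ?case by (cases k) (simp_all add: binomial_eq_0)
next
  case 2
  show ?case
  proof (cases k)
    case (Suc j)
    then show ?thesis by (cases j) (simp_all add: binomial_eq_0 numeral_3_eq_3)
  qed simp
next
  case (3 n)
  have pascal: "(Suc (Suc M) choose Suc (Suc j)) + (M choose Suc (Suc j)) =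
      2 * (Suc M choose Suc (Suc j)) + (M choose j)" for M j
    by simp
  show ?case
  proof (cases k)
    case 0
    then show ?thesis by (simp add: 3)
  next
    case (Suc j)
    have "coeff (theta_int (Suc (Suc n))) k =
        2 * coeff (theta_int (Suc n)) (Suc j) + coeff (theta_int (Suc n)) j - coeff (theta_int n) (Suc j)"
      by (simp add: Suc)
    also have "\<dots> = int ((Suc (Suc n) + k + 1) choose (2 * k + 1)) + int ((Suc (Suc n) + k) choose (2 * k + 1))"
      using pascal[of "n + j + 1" "2 * j + 1"] pascal[of "n + j + 2" "2 * j + 1"]
      unfolding 3 by (simp add: Suc)
    finally show ?thesis .
  qed
qed

lemma degree_theta_int: "degree (theta_int n) = n"
  and lead_coeff_theta_int: "lead_coeff (theta_int n) = 1"
proof -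
  have "coeff (theta_int n) k = 0" if "n < k" for k
    using that by (simp add: coeff_theta_int binomial_eq_0)
  then have "degree (theta_int n) \<le> n" by (intro degree_le) auto
  moreover have "coeff (theta_int n) n = 1"
    by (simp add: coeff_theta_int binomial_eq_0 mult_2)
  ultimately show "degree (theta_int n) = n"
    by (metis le_antisym le_degree zero_neq_one)
  with \<open>coeff (theta_int n) n = 1\<close> show "lead_coeff (theta_int n) = 1" by simp
qed

lemma coeff_theta_int_times:
  assumes "k \<le> n"
  shows "coeff (theta_int n) k * int (2 * k + 1) = int (2 * n + 1) * int ((n + k) choose (2 * k))"
proof -
  have "(2 * k + 1) * ((n + k + 1) choose (2 * k + 1)) = (n + k + 1) * ((n + k) choose (2 * k))"
    using Suc_times_binomial_eq[of "n + k" "2 * k"] by (simp add: mult.commute)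
  moreover have "(2 * k + 1) * ((n + k) choose (2 * k + 1)) = (n - k) * ((n + k) choose (2 * k))"
  proof -
    have "n + k - 2 * k = n - k" using assms by simp
    then show ?thesis
      using binomial_absorb_comp[of "n + k" "2 * k"] binomial_absorption[of "2 * k" "n + k"] 
      by simp
  qed
  ultimately have "(2 * k + 1) * (((n + k + 1) choose (2 * k + 1)) + ((n + k) choose (2 * k + 1))) =
      (n + k + 1 + (n - k)) * ((n + k) choose (2 * k))"
    unfolding distrib_left distrib_right[of "n + k + 1"] by simp
  moreover have "n + k + 1 + (n - k) = 2 * n + 1" using assms by simp
  ultimately have "int (((n + k + 1) choose (2 * k + 1)) + ((n + k) choose (2 * k + 1))) * int (2 * k + 1) =
      int (2 * n + 1) * int ((n + k) choose (2 * k))"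
    by (metis mult.commute of_nat_mult)
  then show ?thesis by (simp add: coeff_theta_int)
qed

lemma map_poly_theta_int: "map_poly of_int (theta_int n) = theta n"
proof (rule poly_eqI)
  fix k
  show "coeff (map_poly of_int (theta_int n)) k = coeff (theta n) k"
  proof (cases "k \<le> n")
    case True
    have eq: "(n + k) choose (n - k) = (n + k) choose (2 * k)"
      using binomial_symmetric[of "n - k" "n + k"] True by (simp add: mult_2)
    have "of_int (coeff (theta_int n) k) * (of_nat (2 * k + 1) :: complex) =
        of_nat (2 * n + 1) * of_nat ((n + k) choose (n - k))"
      using arg_cong[OF coeff_theta_int_times[OF True], of "of_int :: int \<Rightarrow> complex"]
      by (simp only: of_int_mult of_int_of_nat_eq eq)
    moreover have "(of_nat (2 * k + 1) :: complex) \<noteq> 0" by (simp only: of_nat_eq_0_iff)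
    ultimately show ?thesis
      using True by (simp add: theta_def coeff_map_poly coeff_sum sum.delta field_simps)
  next
    case False
    then show ?thesis
      by (simp add: theta_def coeff_map_poly coeff_sum sum.delta coeff_eq_0 degree_theta_int)
  qed
qed

text \<open>For \<open>k < n\<close> the denominator \<open>2 k + 1\<close> is too small to cancel the prime \<open>2 n + 1\<close>.\<close>

lemma prime_dvd_coeff_theta_int:
  assumes "prime (2 * n + 1)" "k < n"
  shows "int (2 * n + 1) dvd coeff (theta_int n) k"
proof -
  have "int (2 * n + 1) dvd coeff (theta_int n) k * int (2 * k + 1)"
    unfolding coeff_theta_int_times[OF less_imp_le[OF assms(2)]] by (rule dvd_triv_left)
  moreover have "\<not> int (2 * n + 1) dvd int (2 * k + 1)"
    using assms(2) by (simp only: int_dvd_int_iff) (auto dest: dvd_imp_le)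
  moreover have "prime (int (2 * n + 1))"
    using assms(1) by (simp only: prime_nat_int_transfer)
  ultimately show ?thesis by (metis prime_dvd_multD)
qed

lemma poly_theta_int_unit:
  fixes s :: complex
  assumes "s \<noteq> 0"
  shows "poly (map_poly of_int (theta_int n)) (s + inverse s - 2) * s ^ n * (s - 1) = s ^ (2 * n + 1) - 1"
proof (induction n rule: theta_int.induct)
  case 2
  show ?case using assms by (simp add: map_poly_pCons field_simps eval_nat_numeral)
next
  case (3 n)
  let ?z = "s + inverse s - 2"
  let ?f = "\<lambda>n. poly (map_poly of_int (theta_int n)) ?z"
  have step: "?f (Suc (Suc n)) = (s + inverse s) * ?f (Suc n) - ?f n"
    unfolding theta_int.simps of_int_hom.poly_map_poly_mult_diff by (simp add: map_poly_pCons)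
  have "?f (Suc (Suc n)) * s ^ Suc (Suc n) * (s - 1) =
      (s ^ 2 + 1) * (?f (Suc n) * s ^ Suc n * (s - 1)) - s ^ 2 * (?f n * s ^ n * (s - 1))"
    unfolding step using assms by (simp add: field_simps power2_eq_square)
  also have "\<dots> = s ^ (2 * Suc (Suc n) + 1) - 1"
    unfolding 3 by (simp add: algebra_simps power2_eq_square)
  finally show ?case .
qed simp

text \<open>Chebyshev polynomials, normalized so that \<open>s + s\<^sup>-\<^sup>1 - 2\<close> is sent to \<open>s\<^sup>k + s\<^sup>-\<^sup>k\<close>.\<close>

fun trace_poly :: "nat \<Rightarrow> int poly" where
  "trace_poly 0 = [:2:]"
| "trace_poly (Suc 0) = [:2, 1:]"
| "trace_poly (Suc (Suc n)) = [:2, 1:] * trace_poly (Suc n) - trace_poly n"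

lemma coeff_0_trace_poly: "coeff (trace_poly k) 0 = 2"
  by (induction k rule: trace_poly.induct) (simp_all add: coeff_mult)

lemma poly_trace_poly:
  fixes s :: complex
  assumes "s \<noteq> 0"
  shows "poly (map_poly of_int (trace_poly k)) (s + inverse s - 2) = s ^ k + inverse s ^ k"
proof (induction k rule: trace_poly.induct)
  case (3 n)
  let ?z = "s + inverse s - 2"
  have "poly (map_poly of_int (trace_poly (Suc (Suc n)))) ?z =
      (s + inverse s) * (s ^ Suc n + inverse s ^ Suc n) - (s ^ n + inverse s ^ n)"
    unfolding trace_poly.simps of_int_hom.poly_map_poly_mult_diff 3 by (simp add: map_poly_pCons)
  also have "\<dots> = s ^ Suc (Suc n) + inverse s ^ Suc (Suc n)"
    using assms by (simp add: field_simps)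
  finally show ?case .
qed (simp_all add: map_poly_pCons)

lemma theta_root_obtain_root_of_unity:
  assumes "poly (theta n) \<omega> = 0"
  obtains s where "s \<noteq> 0" "\<omega> = s + inverse s - 2" "s ^ (2 * n + 1) = 1" "s \<noteq> 1"
proof -
  \<comment> \<open>A root of \<open>s\<^sup>2 - (\<omega> + 2) s + 1\<close>.\<close>
  define s where "s = ((\<omega> + 2) + csqrt ((\<omega> + 2) ^ 2 - 4)) / 2"
  have "2 * s - (\<omega> + 2) = csqrt ((\<omega> + 2) ^ 2 - 4)"
    by (simp add: s_def field_simps)
  then have "(2 * s - (\<omega> + 2)) ^ 2 = (\<omega> + 2) ^ 2 - 4"
    by simp
  moreover have "4 * (s * (\<omega> + 2 - s)) = (\<omega> + 2) ^ 2 - (2 * s - (\<omega> + 2)) ^ 2"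
    by (simp add: power2_eq_square algebra_simps)
  ultimately have s: "s * (\<omega> + 2 - s) = 1"
    by simp
  then have "s \<noteq> 0" by auto
  moreover have "inverse s = \<omega> + 2 - s" using s by (rule inverse_unique)
  then have w: "\<omega> = s + inverse s - 2" by simp
  moreover have "s ^ (2 * n + 1) = 1"
    using poly_theta_int_unit[OF \<open>s \<noteq> 0\<close>, of n] assms w by (simp add: map_poly_theta_int)
  moreover have "s \<noteq> 1"
  proof
    assume "s = 1"
    then have "\<omega> = 0" using w by simp
    then have "of_int (coeff (theta_int n) 0) = (0 :: complex)"
      using assms by (simp add: poly_0_coeff_0 coeff_map_poly flip: map_poly_theta_int)
    then have "coeff (theta_int n) 0 = 0" by (simp only: of_int_eq_0_iff)
    then show False by (simp add: coeff_theta_int)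
  qed
  ultimately show ?thesis using that by blast
qed

text \<open>The \<open>n\<close> numbers \<open>2 cos (2 \<pi> k / (2 n + 1)) - 2\<close> are distinct roots, and there cannot be more.\<close>

lemma proots_theta:
  "proots (theta n) = mset_set {\<omega>. poly (theta n) \<omega> = 0}"
  "finite {\<omega>. poly (theta n) \<omega> = 0}"
  "card {\<omega>. poly (theta n) \<omega> = 0} = n"
proof -
  let ?W = "{\<omega>. poly (theta n) \<omega> = 0}"
  let ?x = "\<lambda>k. 2 * pi * real k / real (2 * n + 1)"
  let ?r = "\<lambda>k. complex_of_real (2 * cos (?x k) - 2)"
  have deg: "degree (theta n) = n"
    by (simp add: degree_map_poly degree_theta_int flip: map_poly_theta_int)
  have "coeff (theta n) n = 1"
    using lead_coeff_theta_int[of n] degree_theta_int[of n]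
    by (simp add: coeff_map_poly flip: map_poly_theta_int)
  then have "theta n \<noteq> 0" by auto
  then show fin: "finite ?W" by (rule poly_roots_finite)
  have range: "0 < ?x k" "?x k < pi" if "k \<in> {1..n}" for k
    using that mult_strict_left_mono[of "2 * real k" "real (2 * n + 1)" pi] by (auto simp: field_simps)
  have "?r ` {1..n} \<subseteq> ?W"
  proof clarify
    fix k assume k: "k \<in> {1..n}"
    define s where "s = cis (?x k)"
    have "s \<noteq> 0" by (simp add: s_def)
    have "s ^ (2 * n + 1) = cis (2 * pi * real k)"
      unfolding s_def Complex.DeMoivre by (simp del: of_nat_add of_nat_mult of_nat_Suc)
    also have "\<dots> = 1" by (rule cis_multiple_2pi) simp
    finally have "s ^ (2 * n + 1) = 1" .
    moreover have "s \<noteq> 1"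
    proof
      assume "s = 1"
      then have "cos (?x k) = 1" by (simp add: s_def complex_eq_iff)
      moreover have "cos (?x k) < cos 0"
        using range[OF k] by (intro cos_monotone_0_pi) auto
      ultimately show False by simp
    qed
    moreover have "s + inverse s - 2 = ?r k"
      by (simp add: s_def complex_eq_iff)
    ultimately show "poly (theta n) (?r k) = 0"
      using poly_theta_int_unit[OF \<open>s \<noteq> 0\<close>, of n] \<open>s \<noteq> 0\<close> by (simp add: map_poly_theta_int)
  qed
  moreover have "inj_on ?r {1..n}"
  proof (rule inj_onI)
    fix j k assume jk: "j \<in> {1..n}" "k \<in> {1..n}" "?r j = ?r k"
    then have "cos (?x j) = cos (?x k)" by (simp only: of_real_eq_iff)
    then have "?x j = ?x k"
      using cos_inj_pi[OF less_imp_le[OF range(1)[OF jk(1)]] less_imp_le[OF range(2)[OF jk(1)]]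
          less_imp_le[OF range(1)[OF jk(2)]] less_imp_le[OF range(2)[OF jk(2)]]] by blast
    then show "j = k" by (simp add: field_simps)
  qed
  ultimately have "n \<le> card ?W"
    using fin card_mono[of ?W "?r ` {1..n}"] card_image[of ?r "{1..n}"] by simp
  moreover have "card ?W \<le> n"
    using card_poly_roots_bound[OF \<open>theta n \<noteq> 0\<close>] deg by simp
  ultimately show card: "card ?W = n" by simp
  have "mset_set ?W \<subseteq># proots (theta n)"
    using fin \<open>theta n \<noteq> 0\<close> by (intro mset_subset_eqI) (simp add: count_mset_set' Suc_le_eq order_root)
  moreover have "size (proots (theta n)) = size (mset_set ?W)"
    using card deg by (simp add: size_proots_complex)
  ultimately show "proots (theta n) = mset_set ?W"
    by (metis mset_subset_size less_irrefl subset_mset.nless_le)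
qed

section \<open>Integrality of the factor\<close>

lemma sum_pair_opposite:
  fixes f :: "nat \<Rightarrow> 'a::comm_monoid_add"
  assumes "0 < a"
  shows "(\<Sum>i<2 * a. f i) = (\<Sum>i\<le>a. if i = 0 \<or> i = a then f i else f i + f (2 * a - i))"
proof -
  have "(\<Sum>i\<le>a. if i = 0 \<or> i = a then f i else f i + f (2 * a - i)) =
      (\<Sum>i\<le>a. f i + (if i \<in> {0<..<a} then f (2 * a - i) else 0))"
    by (intro sum.cong) auto
  also have "\<dots> = (\<Sum>i\<le>a. f i) + (\<Sum>i\<in>{0<..<a}. f (2 * a - i))"
  proof -
    have "(\<Sum>i\<le>a. if i \<in> {0<..<a} then f (2 * a - i) else 0) = (\<Sum>i\<in>{0<..<a}. f (2 * a - i))"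
      by (intro sum.mono_neutral_cong_right) auto
    then show ?thesis by (simp add: sum.distrib)
  qed
  also have "(\<Sum>i\<in>{0<..<a}. f (2 * a - i)) = (\<Sum>i\<in>{a<..<2 * a}. f i)"
    by (rule sum.reindex_bij_witness[of _ "\<lambda>i. 2 * a - i" "\<lambda>i. 2 * a - i"]) auto
  also have "(\<Sum>i\<le>a. f i) + (\<Sum>i\<in>{a<..<2 * a}. f i) = (\<Sum>i\<in>{..a} \<union> {a<..<2 * a}. f i)"
    by (intro sum.union_disjoint[symmetric]) auto
  also have "{..a} \<union> {a<..<2 * a} = {..<2 * a}"
    using assms by auto
  finally show ?thesis ..
qed

lemma exponent_symmetric:
  assumes "antiperiodic s a" "skew_symmetric s a m" "i \<le> 2 * a"
  shows "exponent s a m (2 * a - i) = exponent s a m i"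
proof -
  have "height s (m + (2 * a - i)) = height s (m + i)"
    by (rule height_symmetric[OF assms])
  then show ?thesis by (simp only: exponent_def)
qed

text \<open>The indices \<open>i\<close> and \<open>2 a - i\<close> carry the same power of \<open>t\<close> and the same sign. The fixed points
  \<open>0\<close> and \<open>a\<close> of the reflection remain unpaired.\<close>

lemma height_quot_pairing:
  assumes "antiperiodic s a" "skew_symmetric s a m" "0 < a"
  shows "height_quot s a m c = (\<Sum>i\<le>a. Polynomial.smult
     ((- 1) ^ i * (if i = 0 \<or> i = a then c ^ i else c ^ i + c ^ (2 * a - i))) (quot_monom (exponent s a m i)))"
  unfolding height_quot_def sum_pair_opposite[OF assms(3)]
proof (rule sum.cong[OF HOL.refl])
  fix i assume "i \<in> {..a}"
  then have i: "i \<le> 2 * a" by simp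
  have "(- c) ^ (2 * a - i) = (- 1) ^ i * c ^ (2 * a - i)"
    using i by (subst power_minus) (simp add: minus_one_power_iff)
  then show "(if i = 0 \<or> i = a then Polynomial.smult ((- c) ^ i) (quot_monom (exponent s a m i))
      else Polynomial.smult ((- c) ^ i) (quot_monom (exponent s a m i)) +
        Polynomial.smult ((- c) ^ (2 * a - i)) (quot_monom (exponent s a m (2 * a - i)))) =
      Polynomial.smult ((- 1) ^ i * (if i = 0 \<or> i = a then c ^ i else c ^ i + c ^ (2 * a - i))) (quot_monom (exponent s a m i))"
    using exponent_symmetric[OF assms(1,2) i] power_minus[of c i]
    by (simp add: distrib_left smult_add_left)
qed

text \<open>The polynomial \<open>Q\<close> with \<open>\<omega>\<close> as an indeterminate (the outer variable) and \<open>t\<close> as the inner one.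
  The index \<open>(n + 1) i\<close> appears because \<open>\<eta> = s\<^sup>n\<^sup>+\<^sup>1\<close> is the square root of \<open>s\<close> among the roots of
  unity of order \<open>2 n + 1\<close>.\<close>

definition generic_factor :: "(nat \<Rightarrow> bool) \<Rightarrow> nat \<Rightarrow> nat \<Rightarrow> nat \<Rightarrow> int poly poly" where
  "generic_factor s a m n = (\<Sum>i\<le>a.
     map_poly (\<lambda>c. [:c:]) (Polynomial.smult ((- 1) ^ i) (if i = 0 \<or> i = a then 1 else trace_poly (Suc n * i))) *
     [:quot_monom (exponent s a m i):])"

text \<open>At \<open>\<omega> = 0\<close> all the sums \<open>\<eta>\<^sup>i + \<eta>\<^sup>-\<^sup>i\<close> become \<open>2\<close>, as they are for \<open>\<eta> = 1\<close>.\<close>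

lemma coeff_0_generic_factor:
  assumes "antiperiodic s a" "skew_symmetric s a m" "0 < a"
  shows "coeff (generic_factor s a m n) 0 = height_quot s a m 1"
  unfolding generic_factor_def height_quot_pairing[OF assms] coeff_sum
  by (intro sum.cong) (auto simp: coeff_mult coeff_map_poly coeff_0_trace_poly)

lemma comm_ring_hom_map_poly_of_int: "comm_ring_hom (map_poly of_int :: int poly \<Rightarrow> complex poly)"
  by unfold_locales (auto simp: poly_eq_iff coeff_map_poly coeff_mult)

lemma map_poly_quot_monom: "map_poly of_int (quot_monom d) = (quot_monom d :: complex poly)"
proof (induction d rule: quot_monom.induct)
  case (3 d)
  interpret comm_ring_hom "map_poly of_int :: int poly \<Rightarrow> complex poly"
    by (rule comm_ring_hom_map_poly_of_int)
  show ?case using 3 by (simp add: hom_add map_poly_monom)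
qed simp_all

lemma poly_map_poly_const:
  "poly (map_poly (map_poly of_int) (map_poly (\<lambda>c. [:c:]) f)) [:w :: complex:] = [:poly (map_poly of_int f) w:]"
  by (induction f) (simp_all add: map_poly_pCons)

lemma poly_generic_factor:
  fixes \<eta> :: complex
  assumes "antiperiodic s a" "skew_symmetric s a m" "0 < a"
    and z: "z \<noteq> 0" "z ^ (2 * n + 1) = 1" and \<eta>: "\<eta> = z ^ Suc n" "\<eta> ^ a = 1"
  shows "poly (map_poly (map_poly of_int) (generic_factor s a m n)) [:z + inverse z - 2:] = height_quot s a m \<eta>"
proof -
  interpret comm_ring_hom "map_poly of_int :: int poly \<Rightarrow> complex poly"
    by (rule comm_ring_hom_map_poly_of_int)
  have poly_sum': "poly (map_poly (map_poly of_int) (\<Sum>i\<in>I. F i)) x =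
      (\<Sum>i\<in>I. poly (map_poly (map_poly of_int) (F i)) x)" for F :: "nat \<Rightarrow> int poly poly" and I and x :: "complex poly"
  proof (induction I rule: infinite_finite_induct)
    case (insert i I)
    then show ?case using poly_map_poly_mult_add[of "F i" 1 "sum F I" x] by simp
  qed simp_all
  have "\<eta> \<noteq> 0" using z \<eta> by simp
  have inv: "inverse \<eta> ^ i = \<eta> ^ (2 * a - i)" if "i \<le> a" for i
  proof -
    have "\<eta> ^ i * \<eta> ^ (2 * a - i) = \<eta> ^ (a + a)"
      using that by (simp add: mult_2 flip: power_add)
    also have "\<dots> = 1" by (simp add: power_add \<eta>(2))
    finally show ?thesis by (simp add: power_inverse inverse_unique)
  qed
  have C: "poly (map_poly of_int (Polynomial.smult ((- 1) ^ i) (if i = 0 \<or> i = a then 1 else trace_poly (Suc n * i))))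
      (z + inverse z - 2) = (- 1) ^ i * (if i = 0 \<or> i = a then \<eta> ^ i else \<eta> ^ i + \<eta> ^ (2 * a - i))"
    if "i \<le> a" for i
  proof -
    have "map_poly of_int (Polynomial.smult ((- 1) ^ i) f) = Polynomial.smult ((- 1) ^ i) (map_poly of_int f :: complex poly)" for f
      by (simp add: poly_eq_iff coeff_map_poly)
    moreover have "poly (map_poly of_int (trace_poly (Suc n * i))) (z + inverse z - 2) = \<eta> ^ i + \<eta> ^ (2 * a - i)"
    proof -
      have "z ^ (Suc n * i) = \<eta> ^ i" "inverse z ^ (Suc n * i) = inverse \<eta> ^ i"
        by (simp_all only: power_mult \<eta>(1) power_inverse)
      then show ?thesis
        unfolding poly_trace_poly[OF z(1)] by (simp only: inv[OF that])
    qed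
    ultimately show ?thesis by (auto simp: \<eta>(2))
  qed
  show ?thesis
    unfolding generic_factor_def poly_sum' height_quot_pairing[OF assms(1-3)]
  proof (rule sum.cong[OF HOL.refl])
    fix i assume "i \<in> {..a}"
    then have i: "i \<le> a" by simp
    let ?f = "Polynomial.smult ((- 1) ^ i) (if i = 0 \<or> i = a then 1 else trace_poly (Suc n * i)) :: int poly"
    have "poly (map_poly (map_poly of_int) (map_poly (\<lambda>c. [:c:]) ?f * [:quot_monom (exponent s a m i):])) [:z + inverse z - 2:] =
        [:poly (map_poly of_int ?f) (z + inverse z - 2):] * quot_monom (exponent s a m i)"
      using poly_map_poly_mult_add[of "map_poly (\<lambda>c. [:c:]) ?f" "[:quot_monom (exponent s a m i):]" 0 "[:z + inverse z - 2:]"]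
      unfolding poly_map_poly_const by (simp add: map_poly_pCons map_poly_quot_monom)
    then show "poly (map_poly (map_poly of_int) (map_poly (\<lambda>c. [:c:]) ?f * [:quot_monom (exponent s a m i):])) [:z + inverse z - 2:] =
        Polynomial.smult ((- 1) ^ i * (if i = 0 \<or> i = a then \<eta> ^ i else \<eta> ^ i + \<eta> ^ (2 * a - i))) (quot_monom (exponent s a m i))"
      unfolding C[OF i] by simp
  qed
qed

text \<open>Each root \<open>\<omega>\<close> yields a root of unity \<open>\<eta>\<close> of order \<open>p\<close>, and \<open>p dvd a\<close> gives
  \<open>\<eta>\<^sup>a = 1\<close>. The factors \<open>Q(t)\<close> of the twisted polynomials are the values at the roots of one
  integer polynomial, so that their product is integral.\<close>

lemma integral_total_factor:
  assumes s: "antiperiodic s a" "skew_symmetric s a m" and p: "prime p" "p = 2 * n + 1" "p dvd a" "0 < a"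
    and R: "knot_R a b = alternating_word s (2 * a)"
  obtains f where
    "total_twisted_alexander n a b * tvar ^ (4 * (m + 2 * a) * n) =
       to_fract (map_poly of_int (f * pcompose f [:0, -1:]))"
    "[:int p:] dvd f - height_quot s a m 1 ^ n"
proof -
  let ?hom = "map_poly of_int :: int poly \<Rightarrow> complex poly"
  interpret comm_ring_hom ?hom by (rule comm_ring_hom_map_poly_of_int)
  let ?W = "{\<omega>. poly (theta n) \<omega> = 0}"
  let ?g = "map_poly (\<lambda>c. [:c:]) (theta_int n)" and ?h = "generic_factor s a m n"
  define Q where "Q = (\<lambda>\<omega>. poly (map_poly ?hom ?h) [:\<omega>:])"
  have deg: "degree ?g = n"
    by (simp add: degree_map_poly degree_theta_int)
  have monic: "lead_coeff ?g = 1"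
    using lead_coeff_theta_int[of n] by (simp add: deg coeff_map_poly degree_theta_int one_pCons)
  have fin: "finite ((\<lambda>\<omega>. [:\<omega>:]) ` ?W)"
    using proots_theta(2) by simp
  have inj: "inj_on (\<lambda>\<omega>. [:\<omega>:]) ?W"
    by (simp add: inj_on_def)
  then have card: "card ((\<lambda>\<omega>. [:\<omega>:]) ` ?W) = degree ?g"
    by (simp add: card_image proots_theta(3) deg)
  have roots: "poly (map_poly ?hom ?g) w = 0" if "w \<in> (\<lambda>\<omega>. [:\<omega>:]) ` ?W" for w
    using that by (auto simp: poly_map_poly_const map_poly_theta_int)
  have lower: "[:int p:] dvd coeff ?g k" if "k < degree ?g" for k
    using prime_dvd_coeff_theta_int[of n k] p that by (simp add: deg coeff_map_poly const_poly_dvd_const_poly_iff)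
  obtain f where f: "?hom f = (\<Prod>w\<in>(\<lambda>\<omega>. [:\<omega>:]) ` ?W. poly (map_poly ?hom ?h) w)"
      "[:int p:] dvd f - coeff ?h 0 ^ degree ?g"
    using prod_over_roots_in_image[OF comm_ring_hom_map_poly_of_int monic fin card roots lower, of ?h] by blast
  have f1: "?hom f = (\<Prod>\<omega>\<in>?W. Q \<omega>)"
    using inj by (simp add: f(1) prod.reindex Q_def)
  have comp: "?hom (pcompose g [:0, -1:]) = pcompose (?hom g) [:0, -1:]" for g
    by (induction g) (simp_all add: pcompose_pCons map_poly_pCons hom_add hom_mult hom_uminus)
  have "twisted_alexander a b (tau \<omega>) * tvar ^ (4 * (m + 2 * a)) = to_fract (Q \<omega> * pcompose (Q \<omega>) [:0, -1:])"
    if root: "\<omega> \<in> ?W" for \<omega>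
  proof -
    from root obtain z where z: "z \<noteq> 0" "\<omega> = z + inverse z - 2" "z ^ (2 * n + 1) = 1" "z \<noteq> 1"
      using theta_root_obtain_root_of_unity[of n \<omega>] by auto
    define \<eta> where "\<eta> = z ^ Suc n"
    \<comment> \<open>\<open>\<eta>\<close> is chosen as the square root of \<open>z\<close> that is again a root of unity of order \<open>p\<close>.\<close>
    have "\<eta> ^ 2 = z ^ (2 * n + 1) * z"
      by (simp add: \<eta>_def power2_eq_square mult_2 power_add)
    then have sq: "\<eta> ^ 2 = z" using z(3) by simp
    obtain k where k: "a = p * k" using p(3) by blast
    have "\<eta> ^ p = 1"
      unfolding \<eta>_def power_mult [symmetric] mult.commute[of "Suc n"] using z(3) p(2) by (simp only: power_mult power_one)
    then have "\<eta> ^ a = 1" by (simp add: k power_mult)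
    have "\<eta> ^ 4 \<noteq> 1"
    proof
      assume "\<eta> ^ 4 = 1"
      then have "z ^ 2 = 1" by (simp flip: sq power_mult)
      then have "z ^ (2 * n + 1) = z" by (simp add: power_mult)
      with z show False by simp
    qed
    have "\<eta> ^ 2 + inverse \<eta> ^ 2 - 2 = \<omega>"
      by (simp add: z(2) power_inverse sq)
    moreover have "Q \<omega> = height_quot s a m \<eta>"
      unfolding Q_def z(2)
      by (rule poly_generic_factor) (use s p(4) z \<eta>_def \<open>\<eta> ^ a = 1\<close> in simp_all)
    moreover have "\<eta> ^ (2 * a) = 1"
      using \<open>\<eta> ^ a = 1\<close> by (simp add: mult_2 power_add)
    moreover have "\<eta> \<noteq> 0" using z(1) by (simp add: \<eta>_def)
    ultimately show ?thesis
      using twisted_alexander_factorization[OF R s, of \<eta>] \<open>\<eta> ^ 4 \<noteq> 1\<close> by simp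
  qed
  then have "(\<Prod>\<omega>\<in>?W. twisted_alexander a b (tau \<omega>) * tvar ^ (4 * (m + 2 * a))) =
      (\<Prod>\<omega>\<in>?W. to_fract (Q \<omega> * pcompose (Q \<omega>) [:0, -1:]))"
    by (intro prod.cong) auto
  moreover have "total_twisted_alexander n a b = (\<Prod>\<omega>\<in>?W. twisted_alexander a b (tau \<omega>))"
    unfolding total_twisted_alexander_def proots_theta(1) by (simp add: prod_unfold_prod_mset)
  moreover have "(\<Prod>\<omega>\<in>?W. to_fract (Q \<omega> * pcompose (Q \<omega>) [:0, -1:])) =
      to_fract ((\<Prod>\<omega>\<in>?W. Q \<omega>) * pcompose (\<Prod>\<omega>\<in>?W. Q \<omega>) [:0, -1:])"
    using proots_theta(2)[of n] by (induction rule: finite_induct) (simp_all add: pcompose_mult pcompose_1 mult_ac)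
  ultimately have "total_twisted_alexander n a b * tvar ^ (4 * (m + 2 * a) * n) =
      to_fract (?hom (f * pcompose f [:0, -1:]))"
    by (simp add: prod.distrib proots_theta(3) hom_mult comp f1 flip: power_mult)
  moreover have "[:int p:] dvd f - height_quot s a m 1 ^ n"
    using f(2) by (simp add: coeff_0_generic_factor s p(4) deg)
  ultimately show ?thesis by (rule that)
qed

section \<open>The total twisted Alexander polynomial\<close>

theorem theorem2p2:
  fixes n p \<alpha> \<beta> :: nat and \<Delta> :: "int poly"
  assumes "prime p" and "p = 2 * n + 1"
    and "two_bridge \<alpha> \<beta>"
    and "alexander_polynomial \<alpha> \<beta> \<Delta>"
    and "[poly \<Delta> (-1) = 0] (mod int p)"
  shows "\<exists>D :: int poly. represents D (total_twisted_alexander n \<alpha> \<beta>) \<and>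
    (\<exists>f :: int poly. cong_units p D (f * pcompose f [:0, -1:]) \<and> cong_quotient_power p n f \<Delta>) \<and>
    ((\<alpha>, \<beta>) \<in> H_knots p \<longrightarrow>
      (\<exists>f :: int poly. cong_units p D (f * pcompose f [:0, -1:]) \<and> cong_quotient_power p n f \<Delta> \<and>
         eq_units D (f * pcompose f [:0, -1:])))"
proof -
  define s where "s = positive_letter \<alpha> (odd_slope \<alpha> \<beta>)"
  have \<alpha>: "0 < \<alpha>" "odd \<alpha>" "coprime \<alpha> (odd_slope \<alpha> \<beta>)" "odd (odd_slope \<alpha> \<beta>)"
    using assms(3) coprime_odd_slope[of \<alpha> \<beta>] odd_odd_slope[of \<alpha> \<beta>] by (simp_all add: two_bridge_def)
  have R: "knot_R \<alpha> \<beta> = alternating_word s (2 * \<alpha>)"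
    unfolding s_def by (rule knot_R_eq_alternating_word[OF assms(3)])
  have anti: "antiperiodic s \<alpha>"
    unfolding s_def by (rule antiperiodic_positive_letter[OF \<alpha>(1,4)])
  obtain m where skew: "skew_symmetric s \<alpha> m"
    unfolding s_def by (rule skew_symmetric_positive_letter[OF \<alpha>(2,4,3)])
  let ?A = "alexander_poly s \<alpha> m" and ?Q = "height_quot s \<alpha> m 1 :: int poly"
  have \<Delta>: "eq_units \<Delta> ?A"
    by (rule alexander_polynomial_eq_units(1)[OF anti _ R assms(4)]) (use \<alpha>(1) in simp)
  obtain c k where c: "[:0, 1:] ^ k * ?A = c * \<Delta>"
    using alexander_polynomial_eq_units(2)[OF anti _ R assms(4)] \<alpha>(1) by blast
  \<comment> \<open>At \<open>t = - 1\<close> the Alexander polynomial takes the value \<open>\<plusminus>\<alpha>\<close>.\<close>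
  have "(- 1) ^ k * int \<alpha> = poly c (- 1) * poly \<Delta> (- 1)"
    using arg_cong[OF c, of "\<lambda>f. poly f (- 1)"] by (simp add: poly_alexander_poly_minus_one)
  moreover have "int p dvd poly \<Delta> (- 1)"
    using assms(5) by (simp add: cong_0_iff)
  ultimately have "int p dvd (- 1) ^ k * int \<alpha>" by simp
  then have p_dvd: "p dvd \<alpha>"
    by (cases "even k") simp_all
  obtain f where f:
      "total_twisted_alexander n \<alpha> \<beta> * tvar ^ (4 * (m + 2 * \<alpha>) * n) =
         to_fract (map_poly of_int (f * pcompose f [:0, -1:]))"
      "[:int p:] dvd f - ?Q ^ n"
    using integral_total_factor[OF anti skew assms(1,2) p_dvd \<alpha>(1) R] .
  let ?D = "f * pcompose f [:0, -1:]"
  have "represents ?D (total_twisted_alexander n \<alpha> \<beta>)"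
  proof -
    have "total_twisted_alexander n \<alpha> \<beta> =
        1 * tvar powi (- int (4 * (m + 2 * \<alpha>) * n)) * to_fract (map_poly of_int ?D)"
      unfolding f(1) [symmetric] power_int_minus power_int_of_nat by simp
    then show ?thesis unfolding represents_def by blast
  qed
  moreover have "eq_units ?D ?D"
    unfolding eq_units_def by (intro bexI[of _ 1] exI[of _ 0]) auto
  moreover have "cong_units p ?D ?D"
    unfolding cong_units_def by (intro bexI[of _ 1] exI[of _ 0]) auto
  moreover have "cong_quotient_power p n f \<Delta>"
  proof -
    obtain u i l where u: "u \<in> {1, - 1}" "[:0, 1:] ^ i * \<Delta> = u * [:0, 1:] ^ l * ?A"
      using \<Delta> unfolding eq_units_def by blast
    have "[:0, 1:] ^ i * \<Delta> - (- (u * (- 1) ^ m)) * [:0, 1:] ^ l * ([:1, 1:] * ?Q) = u * [:0, 1:] ^ l * [:int \<alpha>:]"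
      unfolding u(2) alexander_poly_def by (simp only: right_diff_distrib mult_minus_left mult_minus_right mult_ac diff_minus_eq_add diff_add_cancel)
    moreover have "[:int p:] dvd [:int \<alpha>:]"
      using p_dvd by (simp add: const_poly_dvd_const_poly_iff)
    ultimately have "[:int p:] dvd [:0, 1:] ^ i * \<Delta> - (- (u * (- 1) ^ m)) * [:0, 1:] ^ l * ([:1, 1:] * ?Q)"
      by (metis dvd_mult)
    moreover have "- (u * (- 1) ^ m) \<in> {1, - 1 :: int poly}"
      using u(1) by (cases "even m") auto
    ultimately have "cong_units p \<Delta> ([:1, 1:] * ?Q)"
      unfolding cong_units_def by blast
    moreover have "cong_units p f (?Q ^ n)"
      unfolding cong_units_def using f(2) by (intro bexI[of _ 1] exI[of _ 0]) auto
    ultimately show ?thesis unfolding cong_quotient_power_def by blast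
  qed
  ultimately show ?thesis by blast
qed

end
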